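(* Let $SL(2,\mathbb{R})$ act continuously (on the left) on a locally compact space $X$. Let $\nu$ be a Borel probability measure on $X$ of any of the following three types: (1) $\nu$ is invariant under the action of the unipotent subgroup $h_{\mathbb{R}}=\{h_s : s\in\mathbb{R}\}$; (2) $\nu=\frac{1}{S}\int_0^S (h_s)_*(\delta_x)\,ds$ for some $x\in X$ and $S>0$; (3) $\nu=\frac{1}{\Theta}\int_0^\Theta (r_\theta)_*(\delta_x)\,d\theta$ for some $x\in X$ and $\Theta>0$. If the weak* limit $$\mu:=\lim_{T\to+\infty}\frac{1}{T}\int_0^T (g_t)_*(\nu)\,dt$$ exists and is $h_{\mathbb{R}}$-ergodic, then there exists a set $Z\subset\mathbb{R}$ of zero upper density such that, in the weak* topology, $$\lim_{t\to+\infty,\ t\notin Z}(g_t)_*(\nu)=\mu .$$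
   Context: Notation: $g_t=\begin{pmatrix}e^t&0\\0&e^{-t}\end{pmatrix}$, $h_t=\begin{pmatrix}1&t\\0&1\end{pmatrix}$, $r_\theta=\begin{pmatrix}\cos\theta&\sin\theta\\-\sin\theta&\cos\theta\end{pmatrix}$, acting on $X$ through the given $SL(2,\mathbb{R})$-action. $\delta_x$ is the Dirac mass at $x$, and $(\cdot)_*$ denotes push-forward of measures. Weak* convergence of Borel measures on $X$ means convergence of integrals of every continuous compactly supported function on $X$. A set $Z\subset\mathbb{R}$ has zero upper density if $\limsup_{T\to+\infty}\frac1T\mathrm{Leb}(Z\cap[0,T])=0$. "$h_{\mathbb{R}}$-ergodic" means ergodic under the flow $(h_s)_{s\in\mathbb{R}}$.
   Formalization: The locally compact space X is additionally assumed Hausdorff and second countable; for general compact Hausdorff X the claim is false, since one set Z must serve uncountably many test functions. *)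

theory Defs
  imports "HOL-Probability.Probability" "HOL-Algebra.Group_Action"
begin

definition SL2R :: "(real^2^2) monoid" where
  "SL2R = \<lparr>carrier = {A. det A = 1}, mult = (**), one = mat 1\<rparr>"

definition geo :: "real \<Rightarrow> real^2^2" where
  "geo t = vector [vector [exp t, 0], vector [0, exp (- t)]]"

definition horo :: "real \<Rightarrow> real^2^2" where
  "horo t = vector [vector [1, t], vector [0, 1]]"

definition rot :: "real \<Rightarrow> real^2^2" where
  "rot \<theta> = vector [vector [cos \<theta>, sin \<theta>], vector [- sin \<theta>, cos \<theta>]]"

text \<open>In \<^locale>\<open>group_action\<close> the product of the group is sent to the composition of maps, so this is
  a left action. The space \<open>X\<close> is the whole type.\<close>

definition continuous_SL2R_action :: "(real^2^2 \<Rightarrow> 'a::topological_space \<Rightarrow> 'a) \<Rightarrow> bool" where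
  "continuous_SL2R_action act \<longleftrightarrow>
     group_action SL2R UNIV act \<and>
     continuous_on (carrier SL2R \<times> UNIV) (\<lambda>(A, x). act A x)"

definition push :: "('a \<Rightarrow> 'a) \<Rightarrow> 'a::topological_space measure \<Rightarrow> 'a measure" where
  "push f \<nu> = distr \<nu> borel f"

definition dirac :: "'a::topological_space \<Rightarrow> 'a measure" where
  "dirac x = return borel x"

text \<open>The measure \<open>(1 / T) * \<integral>\<^sub>0\<^sup>T M t dt\<close>. The monadic bind is integration of a measurable family
  of measures, here against normalized Lebesgue measure on \<open>[0, T]\<close>; see the lemma below.\<close>

definition time_average :: "real \<Rightarrow> (real \<Rightarrow> 'a measure) \<Rightarrow> 'a measure" where
  "time_average T M = uniform_measure lborel {0..T} \<bind> M"

lemma emeasure_time_average: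
  assumes "T > 0" and M: "M \<in> borel \<rightarrow>\<^sub>M subprob_algebra N" and A: "A \<in> sets N"
  shows "emeasure (time_average T M) A =
    (\<integral>\<^sup>+t\<in>{0..T}. emeasure (M t) A \<partial>lborel) / ennreal T"
proof -
  have M': "M \<in> uniform_measure lborel {0..T} \<rightarrow>\<^sub>M subprob_algebra N"
    using M by (simp add: measurable_def)
  have "(\<lambda>t. emeasure (M t) A) \<in> borel_measurable borel"
    using measurable_compose[OF M measurable_emeasure_subprob_algebra[OF A]] by simp
  then show ?thesis
    using \<open>T > 0\<close> unfolding time_average_def
    by (subst emeasure_bind[OF _ M' A]) (simp_all add: nn_integral_uniform_measure)
qed

definition weak_star_tendsto ::
    "('b \<Rightarrow> 'a::topological_space measure) \<Rightarrow> 'a measure \<Rightarrow> 'b filter \<Rightarrow> bool" where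
  "weak_star_tendsto M \<mu> F \<longleftrightarrow>
     (\<forall>f :: 'a \<Rightarrow> real. continuous_on UNIV f \<and> compact (closure {x. f x \<noteq> 0}) \<longrightarrow>
        ((\<lambda>t. \<integral>x. f x \<partial>M t) \<longlongrightarrow> (\<integral>x. f x \<partial>\<mu>)) F)"

text \<open>As usual, an ergodic measure is an invariant probability measure.\<close>

definition flow_ergodic :: "(real \<Rightarrow> 'a \<Rightarrow> 'a) \<Rightarrow> 'a::topological_space measure \<Rightarrow> bool" where
  "flow_ergodic \<phi> \<mu> \<longleftrightarrow>
     prob_space \<mu> \<and> sets \<mu> = sets borel \<and>
     (\<forall>s. push (\<phi> s) \<mu> = \<mu>) \<and>
     (\<forall>A\<in>sets borel. (\<forall>s. \<phi> s -` A = A) \<longrightarrow> measure \<mu> A = 0 \<or> measure \<mu> A = 1)"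

text \<open>Measurability is required because \<^const>\<open>measure\<close> is \<open>0\<close> on non-measurable sets.\<close>

definition zero_upper_density :: "real set \<Rightarrow> bool" where
  "zero_upper_density Z \<longleftrightarrow>
     Z \<in> sets lebesgue \<and>
     Limsup at_top (\<lambda>T. ereal (measure lebesgue (Z \<inter> {0..T}) / T)) = 0"

end

theory Submission
  imports Defs
begin

text \<open>Write \<open>\<nu>\<^sub>t\<close> for the push-forward of \<open>\<nu>\<close> by \<open>geo t\<close>, fix a compactly supported \<open>f\<close> and let \<open>c\<close> be
  its \<open>\<mu>\<close>-mean. By the mean ergodic theorem for the horocycle flow, some finite convex combination
  \<open>F\<close> of horocycle translates of \<open>f\<close> is close to \<open>c\<close> in \<open>L\<^sup>2(\<mu>)\<close>. In all three cases \<open>\<nu>\<^sub>t\<close> is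
  asymptotically horocycle invariant, because \<open>geo t\<close> expands horocycles, so that
  \<open>\<nu>\<^sub>t(f) - \<nu>\<^sub>t(F)\<close> tends to \<open>0\<close>. Since \<open>(\<nu>\<^sub>t(F) - c)\<^sup>2 \<le> \<nu>\<^sub>t((F - c)\<^sup>2)\<close>, whose time averages
  converge to \<open>\<mu>((F - c)\<^sup>2)\<close>, the time averages of \<open>(\<nu>\<^sub>t(f) - c)\<^sup>2\<close> tend to \<open>0\<close>. The argument of
  Koopman and von Neumann then yields one set of zero density for countably many \<open>f\<close>, and a countable
  family approximating all continuous functions from below suffices.\<close>

section \<open>Averages over time intervals and sets of zero density\<close>

text \<open>A push-forward of \<nu> may be singular to \<mu>, so an estimate in
  \<open>L^2(\<mu>)\<close> says nothing about it by itself. The estimate can be transferred only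
  through test functions and only in time average. The first restriction is why the approximants are
  built from finitely many translates, which keeps them continuous with compact support; the second
  is why an exceptional set of times appears. A displacement of fixed size at time \<open>t\<close>
  comes from an exponentially small one at time \<open>0\<close>, which an average over a fixed arc
  barely notices; for circular arcs there is also a correction by matrices close to the identity,
  which must be controlled uniformly on a space that may be noncompact. Approximation from below
  takes the place of a countable uniformly dense family: since \<mu> and all push-forwards have mass
  \<open>1\<close>, no mass escapes, and one-sided bounds for \<open>B + f\<close> and
  \<open>B - f\<close> give convergence.\<close>

abbreviation unif :: "real \<Rightarrow> real measure" where
  "unif T \<equiv> uniform_measure lborel {0..T}"

lemma prob_space_unif: "T > 0 \<Longrightarrow> prob_space (unif T)"
  by (rule prob_space_uniform_measure) auto

lemma measure_unif:
  assumes "T > 0" "A \<in> sets borel"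
  shows "measure (unif T) A = measure lborel (A \<inter> {0..T}) / T"
  using assms by (subst measure_uniform_measure) (auto simp: Int_commute)

lemma integrable_prob_bounded:
  fixes f :: "'b \<Rightarrow> real"
  assumes "prob_space M" "f \<in> borel_measurable M" "\<And>x. \<bar>f x\<bar> \<le> B"
  shows "integrable M f"
proof -
  interpret prob_space M by fact
  show ?thesis using assms by (intro integrable_const_bound[where B=B]) auto
qed

text \<open>The initial segment \<open>[0, t1]\<close> has weight \<open>t1 / T\<close> under
  \<open>unif T\<close>, so in the limit only the tail counts, where \<open>h\<close> is
  small.\<close>

lemma tendsto_unif_integral_0:
  fixes h :: "real \<Rightarrow> real"
  assumes h [measurable]: "h \<in> borel_measurable borel" and B: "\<And>t. \<bar>h t\<bar> \<le> B"
    and lim: "(h \<longlongrightarrow> 0) at_top"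
  shows "((\<lambda>T. \<integral>t. h t \<partial>unif T) \<longlongrightarrow> 0) at_top"
proof (rule tendstoI)
  fix e :: real assume e: "e > 0"
  have "eventually (\<lambda>t. \<bar>h t\<bar> < e/2) at_top"
    using tendstoD[OF lim, of "e/2"] e by (simp add: dist_real_def)
  then obtain t0 where t0: "\<And>t. t \<ge> t0 \<Longrightarrow> \<bar>h t\<bar> < e/2"
    by (auto simp: eventually_at_top_linorder)
  define t1 where "t1 = max t0 0"
  have B0: "B \<ge> 0" using B[of 0] by linarith
  \<comment> \<open>This threshold forces both \<open>T > t1\<close> and
    \<open>B * t1 / T < e/2\<close>; the \<open>+ 1\<close> keeps the quotient positive even if
    \<open>B * t1 = 0\<close>.\<close>
  have "eventually (\<lambda>T. T > t1 + 2 * (B * t1 + 1) / e) at_top" by (rule eventually_gt_at_top)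
  then show "eventually (\<lambda>T. dist (\<integral>t. h t \<partial>unif T) 0 < e) at_top"
  proof eventually_elim
    fix T assume T: "T > t1 + 2 * (B * t1 + 1) / e"
    have nn: "2 * (B * t1 + 1) / e > 0" using B0 e by (auto simp: t1_def intro!: divide_pos_pos add_nonneg_pos)
    then have T0: "T > 0" "T > t1" using T by (auto simp: t1_def)
    have "T > 2 * (B * t1 + 1) / e" using T by (auto simp: t1_def)
    then have "T * e > 2 * (B * t1 + 1)" using e by (simp add: field_simps)
    then have half: "B * (t1 / T) < e/2" using T0 e by (simp add: field_simps)
    interpret prob_space "unif T" using T0(1) by (rule prob_space_unif)
    have i1: "integrable (unif T) h" using B by (intro integrable_prob_bounded[OF prob_space_axioms]) auto
    have i3: "integrable (unif T) (indicator {0..t1} :: real \<Rightarrow> real)"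
      by (intro integrable_prob_bounded[OF prob_space_axioms, where B=1]) (auto simp: indicator_def)
    have i2: "integrable (unif T) (\<lambda>t. e/2 + B * indicator {0..t1} t)"
      using i3 by auto
    have "\<bar>\<integral>t. h t \<partial>unif T\<bar> \<le> (\<integral>t. \<bar>h t\<bar> \<partial>unif T)"
      by (rule integral_abs_bound)
    also have "\<dots> \<le> (\<integral>t. e/2 + B * indicator {0..t1} t \<partial>unif T)"
    proof (rule integral_mono_AE)
      have "AE t in unif T. t \<in> {0..T}" by (rule AE_uniform_measureI) auto
      then show "AE t in unif T. \<bar>h t\<bar> \<le> e/2 + B * indicator {0..t1} t"
      proof eventually_elim
        fix t assume "t \<in> {0..T}"
        show "\<bar>h t\<bar> \<le> e/2 + B * indicator {0..t1} t"
        proof (cases "t \<le> t1")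
          case True then show ?thesis using B[of t] e \<open>t \<in> {0..T}\<close> by simp
        next
          case False
          then have "\<bar>h t\<bar> < e/2" using t0[of t] by (simp add: t1_def)
          then show ?thesis using False by simp
        qed
      qed
    qed (use i1 i2 in auto)
    also have "\<dots> = e/2 + B * measure (unif T) {0..t1}"
      using i3 by (simp add: prob_space[simplified])
    also have "measure (unif T) {0..t1} = t1 / T"
      using T0 by (subst measure_unif) (auto simp: t1_def Int_absorb2)
    finally have "\<bar>\<integral>t. h t \<partial>unif T\<bar> < e" using half by linarith
    then show "dist (\<integral>t. h t \<partial>unif T) 0 < e" by (simp add: dist_real_def)
  qed
qed

text \<open>The exceptional set is where \<open>\<phi>\<close> exceeds the square root of a decreasing majorant of its
  averages, so that Markov's inequality bounds its density on \<open>[0, T]\<close> by that square root.\<close>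

lemma zero_upper_density_exceptional_set:
  fixes \<phi> :: "real \<Rightarrow> real"
  assumes m [measurable]: "\<phi> \<in> borel_measurable borel" and b: "\<And>t. 0 \<le> \<phi> t" "\<And>t. \<phi> t \<le> 1"
    and lim: "((\<lambda>T. \<integral>t. \<phi> t \<partial>unif T) \<longlongrightarrow> 0) at_top"
  shows "\<exists>Z. zero_upper_density Z \<and> (\<phi> \<longlongrightarrow> 0) (inf at_top (principal (- Z)))"
proof -
  \<comment> \<open>With \<open>max T 1\<close> every measure is a probability measure, so
    \<open>E\<close> stays in \<open>[0, 1]\<close> for all real \<open>T\<close> and the suprema
    below are finite.\<close>
  define E where "E T = (\<integral>t. \<phi> t \<partial>unif (max T 1))" for T
  have pm: "prob_space (unif (max T 1))" for T by (rule prob_space_unif) auto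
  have int: "integrable (unif (max T 1)) \<phi>" for T
    using b by (intro integrable_prob_bounded[OF pm, where B=1]) auto
  have E0: "0 \<le> E T" for T unfolding E_def using b by (intro integral_nonneg_AE) auto
  have E1: "E T \<le> 1" for T 
  proof -
    interpret prob_space "unif (max T 1)" by (rule pm)
    show ?thesis unfolding E_def using int b by (intro integral_le_const) auto
  qed
  have Elim: "(E \<longlongrightarrow> 0) at_top"
    by (rule Lim_transform_eventually[OF lim])
      (auto simp: E_def max_def intro!: eventually_mono[OF eventually_ge_at_top[of 1]])
  \<comment> \<open>The supremum over later times makes \<psi> decreasing. The added term, itself
    decreasing, makes it strictly positive, so that a factor \<open>sqrt (\<psi> T)\<close> can be
    cancelled later.\<close>
  define \<psi> where "\<psi> T = (SUP s\<in>{T..}. E s) + 1 / (1 + \<bar>max T 0\<bar>)" for T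
  have bdd: "bdd_above (E ` A)" for A using E1 by (intro bdd_aboveI[of _ 1]) auto
  have E_le: "E T + 1 / (1 + \<bar>max T 0\<bar>) \<le> \<psi> T" for T unfolding \<psi>_def
    by (intro add_right_mono cSUP_upper bdd) auto
  have \<psi>0: "\<psi> T > 0" for T using E_le[of T] E0[of T] by (smt (verit) divide_pos_pos)
  have anti: "\<psi> T \<le> \<psi> S" if "S \<le> T" for S T unfolding \<psi>_def
    using that by (intro add_mono cSUP_subset_mono bdd divide_left_mono) auto
  have \<psi>lim: "(\<psi> \<longlongrightarrow> 0) at_top"
  proof -
    have "((\<lambda>T. SUP s\<in>{T..}. E s) \<longlongrightarrow> 0) at_top"
    proof (rule tendstoI)
      fix e :: real assume "e > 0"
      then have "eventually (\<lambda>T. E T < e/2) at_top" using order_tendstoD(2)[OF Elim, of "e/2"] by auto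
      then obtain T0 where T0: "\<And>T. T \<ge> T0 \<Longrightarrow> E T < e/2" by (auto simp: eventually_at_top_linorder)
      have "dist (SUP s\<in>{T..}. E s) 0 < e" if "T \<ge> T0" for T
      proof -
        have "(SUP s\<in>{T..}. E s) \<le> e/2" using T0 that by (intro cSUP_least) (auto intro: less_imp_le)
        moreover have "0 \<le> (SUP s\<in>{T..}. E s)" 
          using cSUP_upper[OF _ bdd, of T "{T..}"] E0[of T] by auto
        ultimately show ?thesis using \<open>e > 0\<close> by (simp add: dist_real_def)
      qed
      then show "eventually (\<lambda>T. dist (SUP s\<in>{T..}. E s) 0 < e) at_top"
        by (auto simp: eventually_at_top_linorder)
    qed
    moreover have "((\<lambda>T::real. 1 / (1 + \<bar>max T 0\<bar>)) \<longlongrightarrow> 0) at_top"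
    proof (rule Lim_transform_eventually)
      show "((\<lambda>T::real. inverse (1 + T)) \<longlongrightarrow> 0) at_top"
        by (intro tendsto_inverse_0_at_top filterlim_tendsto_add_at_top[OF tendsto_const] filterlim_ident)
      show "eventually (\<lambda>T::real. inverse (1 + T) = 1 / (1 + \<bar>max T 0\<bar>)) at_top"
        by (rule eventually_mono[OF eventually_ge_at_top[of 0]]) (auto simp: field_simps)
    qed
    ultimately have "((\<lambda>T. (SUP s\<in>{T..}. E s) + 1 / (1 + \<bar>max T 0\<bar>)) \<longlongrightarrow> 0 + 0) at_top"
      by (rule tendsto_add)
    then show ?thesis by (simp add: \<psi>_def[abs_def])
  qed
  have "(\<lambda>T. - \<psi> T) \<in> borel_measurable borel"
    using anti by (intro borel_measurable_mono monoI) auto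
  then have [measurable]: "\<psi> \<in> borel_measurable borel" using borel_measurable_uminus_eq by blast
  define Z where "Z = {t. \<phi> t > sqrt (\<psi> t)}"
  have Zm [measurable]: "Z \<in> sets borel" unfolding Z_def by measurable
  have dens: "measure lebesgue (Z \<inter> {0..T}) / T \<le> sqrt (\<psi> T)" if T: "T \<ge> 1" for T
  proof -
    have T': "max T 1 = T" using T by auto
    interpret prob_space "unif T" using T by (intro prob_space_unif) auto
    have "measure (unif T) Z * sqrt (\<psi> T) = (\<integral>t. sqrt (\<psi> T) * indicator Z t \<partial>unif T)"
      by (simp)
    also have "\<dots> \<le> (\<integral>t. \<phi> t \<partial>unif T)"
    proof (rule integral_mono_AE)
      have "AE t in unif T. t \<in> {0..T}" by (rule AE_uniform_measureI) auto
      then show "AE t in unif T. sqrt (\<psi> T) * indicator Z t \<le> \<phi> t"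
      proof eventually_elim
        fix t assume "t \<in> {0..T}"
        \<comment> \<open>Monotonicity of \<psi> replaces the varying threshold by the constant
          \<open>sqrt (\<psi> T)\<close>, to which Markov's inequality applies.\<close>
        then have sq: "sqrt (\<psi> T) \<le> sqrt (\<psi> t)" using anti by auto
        have "t \<in> Z \<Longrightarrow> sqrt (\<psi> T) \<le> \<phi> t"
          using sq unfolding Z_def mem_Collect_eq by linarith
        then show "sqrt (\<psi> T) * indicator Z t \<le> \<phi> t"
          using b(1)[of t] by (auto simp: indicator_def)
      qed
      show "integrable (unif T) (\<lambda>x. sqrt (\<psi> T) * indicat_real Z x)"
        by (intro integrable_prob_bounded[OF prob_space_axioms, where B="sqrt (\<psi> T)"]) 
          (use \<psi>0[of T] in \<open>auto simp: indicator_def\<close>)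
      show "integrable (unif T) \<phi>" using int[of T] T' by simp
    qed
    also have "\<dots> \<le> \<psi> T" using E_le[of T] T' unfolding E_def 
      by (smt (verit) divide_nonneg_nonneg)
    also have "\<psi> T = sqrt (\<psi> T) * sqrt (\<psi> T)" using \<psi>0[of T] by simp
    finally have "measure (unif T) Z \<le> sqrt (\<psi> T)"
      using \<psi>0[of T] by (elim mult_right_le_imp_le) simp
    then show ?thesis using T measure_unif[OF _ Zm, of T] by (simp add: measure_completion)
  qed
  have "((\<lambda>T. measure lebesgue (Z \<inter> {0..T}) / T) \<longlongrightarrow> 0) at_top"
  proof (rule tendsto_sandwich[of "\<lambda>_. 0" _ _ "\<lambda>T. sqrt (\<psi> T)"])
    show "eventually (\<lambda>T. 0 \<le> measure lebesgue (Z \<inter> {0..T}) / T) at_top"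
      by (rule eventually_mono[OF eventually_ge_at_top[of 1]]) auto
    show "eventually (\<lambda>T. measure lebesgue (Z \<inter> {0..T}) / T \<le> sqrt (\<psi> T)) at_top"
      by (rule eventually_mono[OF eventually_ge_at_top[of 1]]) (use dens in auto)
    show "((\<lambda>T. sqrt (\<psi> T)) \<longlongrightarrow> 0) at_top" using tendsto_real_sqrt[OF \<psi>lim] by simp
  qed simp
  then have "((\<lambda>T. ereal (measure lebesgue (Z \<inter> {0..T}) / T)) \<longlongrightarrow> 0) at_top"
    using tendsto_ereal by (metis zero_ereal_def)
  then have "zero_upper_density Z" unfolding zero_upper_density_def
    by (intro conjI lim_imp_Limsup) (auto simp: trivial_limit_at_top_linorder)
  moreover have "(\<phi> \<longlongrightarrow> 0) (inf at_top (principal (- Z)))"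
  proof (rule tendsto_sandwich[of "\<lambda>_. 0" _ _ "\<lambda>T. sqrt (\<psi> T)"])
    show "eventually (\<lambda>T. 0 \<le> \<phi> T) (inf at_top (principal (- Z)))" using b by auto
    show "eventually (\<lambda>t. \<phi> t \<le> sqrt (\<psi> t)) (inf at_top (principal (- Z)))"
      by (auto simp: eventually_inf_principal Z_def)
    show "((\<lambda>T. sqrt (\<psi> T)) \<longlongrightarrow> 0) (inf at_top (principal (- Z)))" 
      using tendsto_real_sqrt[OF \<psi>lim] by (auto intro: tendsto_mono[OF inf_le1])
  qed simp
  ultimately show ?thesis by blast
qed

text \<open>A weighted sum turns countably many functions into one; its exceptional set serves every
  \<open>v n\<close>, because \<open>v n t \<le> 2 ^ Suc n * \<phi> t\<close>.\<close>

lemma zero_upper_density_exceptional_set_countable: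
  fixes v :: "nat \<Rightarrow> real \<Rightarrow> real"
  assumes m [measurable]: "\<And>n. v n \<in> borel_measurable borel"
    and b: "\<And>n t. 0 \<le> v n t" "\<And>n t. v n t \<le> 1"
    and lim: "\<And>n. ((\<lambda>T. \<integral>t. v n t \<partial>unif T) \<longlongrightarrow> 0) at_top"
  shows "\<exists>Z. zero_upper_density Z \<and> (\<forall>n. (v n \<longlongrightarrow> 0) (inf at_top (principal (- Z))))"
proof -
  define \<phi> where "\<phi> t = (\<Sum>n. (1/2) ^ Suc n * v n t)" for t
  have geo: "(\<lambda>n. (1/2::real) ^ Suc n) sums 1" using power_half_series by simp
  have le: "(1/2) ^ Suc n * v n t \<le> (1/2) ^ Suc n" for n t
    using b by (intro mult_left_le) auto
  have summ: "summable (\<lambda>n. (1/2) ^ Suc n * v n t)" for t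
    using b le by (intro summable_comparison_test'[OF sums_summable[OF geo]]) auto
  have [measurable]: "\<phi> \<in> borel_measurable borel" unfolding \<phi>_def by measurable
  have \<phi>0: "0 \<le> \<phi> t" for t unfolding \<phi>_def using summ b by (intro suminf_nonneg) auto
  have \<phi>1: "\<phi> t \<le> 1" for t unfolding \<phi>_def
    using suminf_le[OF le summ sums_summable[OF geo]] sums_unique[OF geo] by auto
  \<comment> \<open>The terms from \<open>N\<close> on contribute at most \<open>(1/2) ^ N\<close>,
    uniformly in \<open>t\<close>, so only a finite sum matters for the limit of the
    averages.\<close>
  have tail: "\<phi> t \<le> (\<Sum>n<N. v n t) + (1/2) ^ N" for t N
  proof -
    have "\<phi> t = (\<Sum>n. (1/2) ^ Suc (n + N) * v (n + N) t) + (\<Sum>n<N. (1/2) ^ Suc n * v n t)"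
      unfolding \<phi>_def by (rule suminf_split_initial_segment[OF summ])
    moreover have "(\<Sum>n<N. (1/2) ^ Suc n * v n t) \<le> (\<Sum>n<N. v n t)"
      using b by (intro sum_mono mult_left_le_one_le) (auto intro: power_le_one simp del: power_Suc)
    moreover have "(\<Sum>n. (1/2) ^ Suc (n + N) * v (n + N) t) \<le> (\<Sum>n. (1/2) ^ N * (1/2) ^ Suc n)"
    proof (rule suminf_le)
      show "(1/2) ^ Suc (n + N) * v (n + N) t \<le> (1/2) ^ N * (1/2) ^ Suc n" for n
        using le[of "n+N" t] by (simp add: power_add mult.commute)
      show "summable (\<lambda>n. (1/2) ^ Suc (n + N) * v (n + N) t)"
        using summ by (rule summable_ignore_initial_segment)
      show "summable (\<lambda>n. (1/2) ^ N * (1/2::real) ^ Suc n)"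
        using sums_summable[OF geo] by (rule summable_mult)
    qed
    moreover have "(\<Sum>n. (1/2) ^ N * (1/2::real) ^ Suc n) = (1/2) ^ N"
      using sums_mult[OF geo, of "(1/2)^N"] by (simp add: sums_iff)
    ultimately show ?thesis by linarith
  qed
  have "((\<lambda>T. \<integral>t. \<phi> t \<partial>unif T) \<longlongrightarrow> 0) at_top"
  proof (rule tendstoI)
    fix e :: real assume e: "e > 0"
    obtain N where N: "(1/2::real) ^ N < e/2" using real_arch_pow_inv[of "e/2" "1/2"] e by auto
    have "((\<lambda>T. \<Sum>n<N. \<integral>t. v n t \<partial>unif T) \<longlongrightarrow> (\<Sum>n<N. 0)) at_top"
      by (intro tendsto_sum lim)
    then have "eventually (\<lambda>T. (\<Sum>n<N. \<integral>t. v n t \<partial>unif T) < e/2) at_top"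
      using order_tendstoD(2)[of _ 0 at_top "e/2"] e by simp
    then show "eventually (\<lambda>T. dist (\<integral>t. \<phi> t \<partial>unif T) 0 < e) at_top"
      using eventually_gt_at_top[of 0]
    proof eventually_elim
      fix T :: real assume T: "(\<Sum>n<N. \<integral>t. v n t \<partial>unif T) < e/2" "0 < T"
      interpret prob_space "unif T" using T(2) by (rule prob_space_unif)
      have iv: "integrable (unif T) (v n)" for n
        using b by (intro integrable_prob_bounded[OF prob_space_axioms, where B=1]) auto
      have ip: "integrable (unif T) \<phi>"
        using \<phi>0 \<phi>1 by (intro integrable_prob_bounded[OF prob_space_axioms, where B=1]) auto
      have "(\<integral>t. \<phi> t \<partial>unif T) \<le> (\<integral>t. (\<Sum>n<N. v n t) + (1/2) ^ N \<partial>unif T)"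
        using iv ip tail by (intro integral_mono) auto
      also have "\<dots> = (\<Sum>n<N. \<integral>t. v n t \<partial>unif T) + (1/2) ^ N"
        using iv prob_space by simp
      also have "\<dots> < e" using T N by simp
      finally show "dist (\<integral>t. \<phi> t \<partial>unif T) 0 < e"
        using \<phi>0 by (simp add: dist_real_def)
    qed
  qed
  then obtain Z where Z: "zero_upper_density Z" "(\<phi> \<longlongrightarrow> 0) (inf at_top (principal (- Z)))"
    using zero_upper_density_exceptional_set[of \<phi>] \<phi>0 \<phi>1 by auto
  have "(v n \<longlongrightarrow> 0) (inf at_top (principal (- Z)))" for n
  proof (rule tendsto_sandwich[of "\<lambda>_. 0" _ _ "\<lambda>t. 2 ^ Suc n * \<phi> t"])
    have "(1/2) ^ Suc n * v n t \<le> \<phi> t" for t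
      using sum_le_suminf[OF summ, of "{n}" t] b by (auto simp: \<phi>_def)
    then have "v n t \<le> 2 ^ Suc n * \<phi> t" for t by (simp add: power_one_over field_simps)
    then show "eventually (\<lambda>t. v n t \<le> 2 ^ Suc n * \<phi> t) (inf at_top (principal (- Z)))" by auto
    show "((\<lambda>t. 2 ^ Suc n * \<phi> t) \<longlongrightarrow> 0) (inf at_top (principal (- Z)))"
      using tendsto_mult_right_zero[OF Z(2)] by simp
  qed (use b in auto)
  with Z(1) show ?thesis by blast
qed

section \<open>Compactly supported functions\<close>

definition Cc :: "('a::topological_space \<Rightarrow> real) set" where
  "Cc = {f. continuous_on UNIV f \<and> compact (closure {x. f x \<noteq> 0})}"

lemma Cc_continuous: "f \<in> Cc \<Longrightarrow> continuous_on UNIV f"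
  by (simp add: Cc_def)

lemma Cc_compact: "f \<in> Cc \<Longrightarrow> compact (closure {x. f x \<noteq> 0})"
  by (simp add: Cc_def)

lemma Cc_measurable [measurable_dest]: "f \<in> Cc \<Longrightarrow> f \<in> borel_measurable borel"
  by (simp add: Cc_continuous borel_measurable_continuous_onI)

lemma CcI:
  fixes g :: "'a::t2_space \<Rightarrow> real"
  assumes "continuous_on UNIV g" "compact K" "\<And>x. x \<notin> K \<Longrightarrow> g x = 0"
  shows "g \<in> Cc"
proof -
  have "closure {x. g x \<noteq> 0} \<subseteq> K"
    using assms by (intro closure_minimal compact_imp_closed) auto
  then have "compact (closure {x. g x \<noteq> 0})"
    using compact_Int_closed[OF assms(2) closed_closure[of "{x. g x \<noteq> 0}"]] by (simp add: Int_absorb1)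
  with assms(1) show ?thesis by (simp add: Cc_def)
qed

lemma Cc_eq_0: "x \<notin> closure {x. f x \<noteq> 0} \<Longrightarrow> f x = 0"
  using closure_subset[of "{x. f x \<noteq> 0}"] by blast

lemma Cc_bounded:
  assumes "f \<in> Cc"
  obtains B where "B \<ge> 0" "\<And>x. \<bar>f x\<bar> \<le> B"
proof -
  have "compact (f ` closure {x. f x \<noteq> 0})"
    using assms by (intro compact_continuous_image) (auto simp: Cc_def intro: continuous_on_subset)
  then obtain B where B: "\<And>x. x \<in> closure {x. f x \<noteq> 0} \<Longrightarrow> \<bar>f x\<bar> \<le> B"
    using compact_imp_bounded bounded_iff[of "f ` closure {x. f x \<noteq> 0}"] by auto
  have "\<bar>f x\<bar> \<le> max B 0" for x
    using B[of x] Cc_eq_0[of x f] by (cases "x \<in> closure {x. f x \<noteq> 0}") auto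
  then show ?thesis using that[of "max B 0"] by auto
qed

text \<open>Off both supports the value is \<open>h 0 0\<close>. Maxima, midpoints, multiples and
  squares are all instances; for the unary ones \<open>g = f\<close> and \<open>h\<close> ignores
  its second argument.\<close>

lemma Cc_compose:
  fixes h :: "real \<Rightarrow> real \<Rightarrow> real" and f g :: "'a::t2_space \<Rightarrow> real"
  assumes "f \<in> Cc" "g \<in> Cc" and h: "continuous_on UNIV (\<lambda>x. h (f x) (g x))" "h 0 0 = 0"
  shows "(\<lambda>x. h (f x) (g x)) \<in> Cc"
proof (rule CcI[OF h(1)])
  show "compact (closure {x. f x \<noteq> 0} \<union> closure {x. g x \<noteq> 0})"
    using assms by (intro compact_Un Cc_compact)
  show "h (f x) (g x) = 0" if "x \<notin> closure {x. f x \<noteq> 0} \<union> closure {x. g x \<noteq> 0}" for x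
  proof -
    have "f x = 0" "g x = 0" using that by (intro Cc_eq_0; blast)+
    then show ?thesis using h(2) by simp
  qed
qed

lemma Cc_max:
  fixes f g :: "'a::t2_space \<Rightarrow> real"
  assumes "f \<in> Cc" "g \<in> Cc"
  shows "(\<lambda>x. max (f x) (g x)) \<in> Cc"
  by (rule Cc_compose[where h=max, OF assms]) (auto intro!: continuous_intros assms[THEN Cc_continuous])

lemma Cc_midpoint:
  fixes f g :: "'a::t2_space \<Rightarrow> real"
  assumes "f \<in> Cc" "g \<in> Cc"
  shows "(\<lambda>x. (f x + g x) / 2) \<in> Cc"
  by (rule Cc_compose[where h="\<lambda>a b. (a + b) / 2", OF assms]) (auto intro!: continuous_intros assms[THEN Cc_continuous])

lemma Cc_scale:
  fixes f :: "'a::t2_space \<Rightarrow> real"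
  assumes "f \<in> Cc"
  shows "(\<lambda>x. c * f x) \<in> Cc"
  by (rule Cc_compose[where h="\<lambda>a b. c * a" and g=f, OF assms assms]) (auto intro!: continuous_intros assms[THEN Cc_continuous])

lemma Cc_square:
  fixes f :: "'a::t2_space \<Rightarrow> real"
  assumes "f \<in> Cc"
  shows "(\<lambda>x. (f x)\<^sup>2) \<in> Cc"
  by (rule Cc_compose[where h="\<lambda>a b. a\<^sup>2" and g=f, OF assms assms]) (auto intro!: continuous_intros assms[THEN Cc_continuous])

lemma Cc_zero: "(\<lambda>x::'a::t2_space. 0) \<in> Cc"
  by (rule CcI[where K="{}"]) auto

lemma Cc_Max:
  fixes S :: "('a::t2_space \<Rightarrow> real) set"
  assumes "finite S" "S \<subseteq> Cc"
  shows "(\<lambda>x. Max (insert 0 ((\<lambda>d. d x) ` S))) \<in> Cc"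
  using assms
proof (induction S rule: finite_induct)
  case empty then show ?case by (simp add: Cc_zero)
next
  case (insert d S)
  have "Max (insert 0 ((\<lambda>d. d x) ` insert d S)) = max (d x) (Max (insert 0 ((\<lambda>d. d x) ` S)))" for x
  proof -
    have "insert 0 ((\<lambda>d. d x) ` insert d S) = insert (d x) (insert 0 ((\<lambda>d. d x) ` S))" by auto
    moreover have "Max (insert (d x) (insert 0 ((\<lambda>d. d x) ` S))) = max (d x) (Max (insert 0 ((\<lambda>d. d x) ` S)))"
      using insert.hyps(1) by (intro Max_insert) auto
    ultimately show ?thesis by (simp only:)
  qed
  moreover have "(\<lambda>x. max (d x) (Max (insert 0 ((\<lambda>d. d x) ` S)))) \<in> Cc"
    by (rule Cc_max) (use insert in auto)
  ultimately show ?case by (simp only:)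
qed

text \<open>A locally compact Hausdorff space is completely regular. Separating \<open>x\<close>
  from the complement of \<open>U \<inter> W\<close>, where \<open>U\<close> lies in a compact set,
  gives compact support together with vanishing off \<open>W\<close>.\<close>

lemma exists_bump:
  fixes x :: "'a::{second_countable_topology, t2_space}"
  assumes lc: "locally_compact_space (euclidean :: 'a topology)" and W: "open W" "x \<in> W"
  obtains V \<phi> where "open V" "x \<in> V" "\<phi> \<in> Cc" "\<And>y. 0 \<le> \<phi> y" "\<And>y. \<phi> y \<le> 1"
    "\<And>y. y \<in> V \<Longrightarrow> \<phi> y = 1" "\<And>y. y \<notin> W \<Longrightarrow> \<phi> y = 0"
proof -
  have "\<exists>U K. openin euclidean U \<and> compactin euclidean K \<and> x \<in> U \<and> U \<subseteq> K"
    using lc unfolding locally_compact_space_def by (rule bspec) simp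
  then obtain U K where UK: "open U" "compact K" "x \<in> U" "U \<subseteq> K"
    unfolding compactin_euclidean_iff open_openin[symmetric] by blast
  have cr: "completely_regular_space (euclidean :: 'a topology)"
  proof (rule locally_compact_regular_imp_completely_regular_space[OF lc], rule disjI1)
    show "Hausdorff_space (euclidean :: 'a topology)"
      using hausdorff unfolding Hausdorff_space_def disjnt_def open_openin[symmetric] by metis
  qed
  have "closedin euclidean (- (U \<inter> W)) \<and> x \<in> topspace euclidean - - (U \<inter> W)"
    using UK W by auto
  from cr[unfolded completely_regular_space_def, rule_format, OF this]
  obtain g :: "'a \<Rightarrow> real" where
    g: "continuous_map euclidean (top_of_set {0..1}) g" "g x = 0" "g ` (- (U \<inter> W)) \<subseteq> {1}"
    by blast
  have g1: "g y = 1" if "y \<notin> U \<inter> W" for y using g(3) that by blast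
  have gc: "continuous_on UNIV g" and g01: "\<And>y. 0 \<le> g y" "\<And>y. g y \<le> 1"
    using g(1) by (auto simp: continuous_map_in_subtopology Pi_iff)
  \<comment> \<open>Doubling and truncating gives the value \<open>1\<close> on the whole
    neighbourhood \<open>g < 1/2\<close> of \<open>x\<close>, which leaves room for a basis set
    inside it.\<close>
  define \<phi> where "\<phi> y = min 1 (2 * (1 - g y))" for y
  show ?thesis
  proof (rule that[of "{y. g y < 1/2}" \<phi>])
    show "open {y. g y < 1/2}" using gc by (intro open_Collect_less continuous_intros)
    have "g y = 1" if "y \<notin> K" for y using g1[of y] that UK(4) by blast
    then show "\<phi> \<in> Cc"
      by (intro CcI[OF _ UK(2)]) (auto simp: \<phi>_def[abs_def] intro!: continuous_intros gc)
    show "\<phi> y = 0" if "y \<notin> W" for y using g1 that by (auto simp: \<phi>_def)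
  qed (use g(2) g01 in \<open>auto simp: \<phi>_def\<close>)
qed

text \<open>The functions \<open>D n\<close> are the finite maxima of rational multiples of bump functions,
  one for each admissible pair of members of a countable basis.\<close>

lemma countable_approximation_from_below:
  assumes lc: "locally_compact_space (euclidean :: 'a::{second_countable_topology, t2_space} topology)"
  obtains D :: "nat \<Rightarrow> 'a::{second_countable_topology, t2_space} \<Rightarrow> real" where "\<And>n. D n \<in> Cc"
    "\<And>f. continuous_on UNIV f \<Longrightarrow> (\<And>x. 0 \<le> f x) \<Longrightarrow>
      \<exists>r. \<forall>x. (\<forall>k. 0 \<le> D (r k) x \<and> D (r k) x \<le> f x) \<and> (\<lambda>k. D (r k) x) \<longlonglongrightarrow> f x"
proof -
  obtain \<B> :: "'a set set" where \<B>: "countable \<B>" "topological_basis \<B>"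
    using ex_countable_basis by blast
  define P where "P A B \<phi> \<longleftrightarrow> \<phi> \<in> Cc \<and> (\<forall>y. 0 \<le> \<phi> y) \<and> (\<forall>y. \<phi> y \<le> 1) \<and>
    (\<forall>y\<in>A. \<phi> y = 1) \<and> (\<forall>y. y \<notin> B \<longrightarrow> \<phi> y = 0)" for A B :: "'a set" and \<phi> :: "'a \<Rightarrow> real"
  define \<Phi> where "\<Phi> A B = (SOME \<phi>. P A B \<phi>)" for A B
  define I where "I = {p \<in> \<B> \<times> \<B>. \<exists>\<phi>. P (fst p) (snd p) \<phi>}"
  have P\<Phi>: "P A B (\<Phi> A B)" if "(A, B) \<in> I" for A B
    using that someI_ex[of "P A B"] unfolding I_def \<Phi>_def by auto
  define D0 where "D0 = insert (\<lambda>x. 0) ((\<lambda>(p, q) x. of_rat q * \<Phi> (fst p) (snd p) x) ` (I \<times> (UNIV :: rat set)))"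
  have "countable I" unfolding I_def using \<B>(1) 
    by (intro countable_subset[OF _ countable_SIGMA[of \<B> "\<lambda>_. \<B>"]]) auto
  then have "countable D0" unfolding D0_def by (intro countable_insert countable_image countable_SIGMA) auto
  have D0Cc: "D0 \<subseteq> Cc"
    using P\<Phi> by (auto simp: D0_def P_def intro!: Cc_zero Cc_scale)
  define D1 where "D1 = (\<lambda>S x. Max (insert 0 ((\<lambda>d. d x) ` S))) ` {S. finite S \<and> S \<subseteq> D0}"
  have cD1: "countable D1" unfolding D1_def
    using countable_Collect_finite_subset[OF \<open>countable D0\<close>] by (intro countable_image)
  have neD1: "D1 \<noteq> {}" unfolding D1_def by blast
  have D1Cc: "D1 \<subseteq> Cc" using D0Cc by (auto simp: D1_def intro!: Cc_Max)
  show ?thesis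
  proof (rule that[of "from_nat_into D1"])
    show "from_nat_into D1 n \<in> Cc" for n using from_nat_into[OF neD1] D1Cc by blast
    fix f :: "'a \<Rightarrow> real" assume f: "continuous_on UNIV f" and f0: "\<And>x. 0 \<le> f x"
    define S where "S = {d \<in> D0. \<forall>x. d x \<le> f x}"
    have "(\<lambda>x. 0) \<in> S" using f0 by (auto simp: S_def D0_def)
    then have neS: "S \<noteq> {}" by blast
    have cS: "countable S" using \<open>countable D0\<close> by (rule countable_subset[rotated]) (auto simp: S_def)
    define e where "e = from_nat_into S"
    have eS: "e k \<in> S" for k unfolding e_def by (rule from_nat_into[OF neS])
    \<comment> \<open>The good member of \<open>S\<close> depends on the point; running maxima over
      an enumeration give one sequence that works at every point.\<close>
    define m where "m k x = Max (insert 0 ((\<lambda>d. d x) ` e ` {..k}))" for k x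
    have mD1: "m k \<in> D1" for k
      unfolding D1_def m_def[abs_def] using eS by (intro image_eqI[OF refl]) (auto simp: S_def)
    have m0: "0 \<le> m k x" for k x by (simp add: m_def)
    have mf: "m k x \<le> f x" for k x using eS f0 by (auto simp: m_def S_def)
    have em: "e j x \<le> m k x" if "j \<le> k" for j k x using that unfolding m_def by (intro Max_ge) auto
    have lim: "(\<lambda>k. m k x) \<longlonglongrightarrow> f x" for x
    proof (rule LIMSEQ_I)
      fix \<epsilon> :: real assume \<epsilon>: "\<epsilon> > 0"
      have "\<exists>j. f x - \<epsilon> < max 0 (e j x)"
      \<comment> \<open>For small \<open>f x\<close> the \<open>0\<close> in the maximum suffices.
        Otherwise \<open>f x - \<epsilon>\<close> is nonnegative, and hence so is the rational
        \<open>q\<close> above it.\<close>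
      proof (cases "f x < \<epsilon>")
        case True then show ?thesis by (intro exI) linarith
      next
        case False
        with \<epsilon> obtain q where q: "f x - \<epsilon> < of_rat q" "of_rat q < f x"
          using of_rat_dense[of "f x - \<epsilon>" "f x"] by auto
        with False have q0: "0 \<le> (of_rat q :: real)" by linarith
        have W: "open {y. of_rat q < f y}" using f by (intro open_Collect_less continuous_intros)
        with q obtain B where B: "B \<in> \<B>" "x \<in> B" "B \<subseteq> {y. of_rat q < f y}"
          using topological_basisE[OF \<B>(2) W, of x] by auto
        have "open B" using \<B>(2) B(1) by (rule topological_basis_open)
        then obtain V \<phi> where V: "open V" "x \<in> V" "\<phi> \<in> Cc" "\<And>y. 0 \<le> \<phi> y" "\<And>y. \<phi> y \<le> 1"
          "\<And>y. y \<in> V \<Longrightarrow> \<phi> y = 1" "\<And>y. y \<notin> B \<Longrightarrow> \<phi> y = 0"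
          using exists_bump[OF lc _ B(2)] by metis
        obtain A where A: "A \<in> \<B>" "x \<in> A" "A \<subseteq> V"
          using topological_basisE[OF \<B>(2) V(1,2)] by auto
        have "P A B \<phi>" using V A(3) by (auto simp: P_def)
        \<comment> \<open>Here \<phi> only witnesses that the pair is admissible; from now on the
          chosen \<open>\<Phi> A B\<close> is used, which has the same defining properties.\<close>
        then have AB: "(A, B) \<in> I" using A B by (auto simp: I_def)
        note p = P\<Phi>[OF AB, unfolded P_def]
        define d where "d = (\<lambda>x. of_rat q * \<Phi> A B x)"
        have "d y \<le> f y" for y
        proof (cases "y \<in> B")
          case True
          have "of_rat q * \<Phi> A B y \<le> of_rat q" using p q0 by (intro mult_left_le) auto
          also have "\<dots> \<le> f y" using True B(3) by auto
          finally show ?thesis by (simp add: d_def)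
        qed (use p f0 in \<open>simp add: d_def\<close>)
        moreover have "d \<in> D0" unfolding D0_def d_def using AB
          by (intro insertI2 image_eqI[where x="((A, B), q)"]) auto
        ultimately have "d \<in> S" by (auto simp: S_def)
        then obtain j where "e j = d" using from_nat_into_surj[OF cS] unfolding e_def by blast
        moreover have "d x = of_rat q" using p A(2) by (simp add: d_def)
        ultimately show ?thesis using q by (intro exI[of _ j]) auto
      qed
      then obtain j where j: "f x - \<epsilon> < max 0 (e j x)" by blast
      show "\<exists>no. \<forall>n\<ge>no. norm (m n x - f x) < \<epsilon>"
      proof (intro exI allI impI)
        fix n assume "n \<ge> j"
        then show "norm (m n x - f x) < \<epsilon>" using j em[of j n x] m0[of n x] mf[of n x] by auto
      qed
    qed
    show "\<exists>r. \<forall>x. (\<forall>k. 0 \<le> from_nat_into D1 (r k) x \<and> from_nat_into D1 (r k) x \<le> f x) \<and>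
        (\<lambda>k. from_nat_into D1 (r k) x) \<longlonglongrightarrow> f x"
      using m0 mf lim mD1 cD1 by (intro exI[of _ "\<lambda>k. to_nat_on D1 (m k)"]) auto
  qed
qed

text \<open>Approximation from below yields only lower bounds in the limit. Applied to
  \<open>B + f\<close> and \<open>B - f\<close>, with all total masses equal to \<open>1\<close>,
  they control the integral of \<open>f\<close> from both sides.\<close>

lemma tendsto_integral_of_countable:
  fixes M :: "'b \<Rightarrow> 'a::topological_space measure" and f :: "'a \<Rightarrow> real"
  assumes M: "\<And>t. prob_space (M t)" "\<And>t. sets (M t) = sets borel"
    and \<mu>: "prob_space \<mu>" "sets \<mu> = sets borel"
    and D: "\<And>n. D n \<in> Cc"
    "\<And>f. continuous_on UNIV f \<Longrightarrow> (\<And>x. 0 \<le> f x) \<Longrightarrow>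
      \<exists>r. \<forall>x. (\<forall>k. 0 \<le> D (r k) x \<and> D (r k) x \<le> f x) \<and> (\<lambda>k. D (r k) x) \<longlonglongrightarrow> f x"
    and lim: "\<And>n. ((\<lambda>t. \<integral>x. D n x \<partial>M t) \<longlongrightarrow> (\<integral>x. D n x \<partial>\<mu>)) F"
    and f: "continuous_on UNIV f" "\<And>x. \<bar>f x\<bar> \<le> B"
  shows "((\<lambda>t. \<integral>x. f x \<partial>M t) \<longlongrightarrow> (\<integral>x. f x \<partial>\<mu>)) F"
proof -
  have int: "integrable N f" if "prob_space N" "sets N = sets borel" "continuous_on UNIV f" "\<And>x. \<bar>f x\<bar> \<le> B"
    for N :: "'a measure" and f :: "'a \<Rightarrow> real" and B
    using that by (intro integrable_prob_bounded[where B=B])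
      (auto simp: borel_measurable_continuous_onI cong: measurable_cong_sets)
  \<comment> \<open>By dominated convergence some \<open>D (r k)\<close> below \<open>f\<close> has
    nearly the same \<mu>-integral, and for that one function the limit is known. Compact support of
    \<open>f\<close> is not assumed, since \<open>B + f\<close> rarely has it.\<close>
  have lower: "eventually (\<lambda>t. (\<integral>x. f x \<partial>\<mu>) - \<epsilon> < (\<integral>x. f x \<partial>M t)) F"
    if f: "continuous_on UNIV f" "\<And>x. 0 \<le> f x" "\<And>x. f x \<le> B" and \<epsilon>: "\<epsilon> > 0"
    for f :: "'a \<Rightarrow> real" and B \<epsilon>
  proof -
    have fB: "\<bar>f x\<bar> \<le> B" for x using f(2,3)[of x] by auto
    obtain r where r: "\<And>x k. 0 \<le> D (r k) x" "\<And>x k. D (r k) x \<le> f x" "\<And>x. (\<lambda>k. D (r k) x) \<longlonglongrightarrow> f x"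
      using D(2)[OF f(1,2)] by blast
    have Dc: "continuous_on UNIV (D n)" for n using D(1) by (rule Cc_continuous)
    have iD: "integrable N (D (r k))" if "prob_space N" "sets N = sets borel" for N k
    proof (rule int[OF that Dc])
      show "\<bar>D (r k) x\<bar> \<le> B" for x using r(1,2)[of k x] f(3)[of x] by linarith
    qed
    have "(\<lambda>k. \<integral>x. D (r k) x \<partial>\<mu>) \<longlonglongrightarrow> (\<integral>x. f x \<partial>\<mu>)"
      by (rule integral_dominated_convergence[where w=f])
        (use \<mu> r int[OF \<mu> f(1) fB] iD[OF \<mu>] in \<open>auto intro: borel_measurable_integrable\<close>)
    then have "eventually (\<lambda>k. (\<integral>x. f x \<partial>\<mu>) - \<epsilon>/2 < (\<integral>x. D (r k) x \<partial>\<mu>)) sequentially"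
      using \<epsilon> by (intro order_tendstoD) auto
    then obtain k where k: "(\<integral>x. f x \<partial>\<mu>) - \<epsilon>/2 < (\<integral>x. D (r k) x \<partial>\<mu>)"
      by (auto simp: eventually_sequentially)
    have "eventually (\<lambda>t. (\<integral>x. D (r k) x \<partial>\<mu>) - \<epsilon>/2 < (\<integral>x. D (r k) x \<partial>M t)) F"
      using \<epsilon> by (intro order_tendstoD(1)[OF lim]) auto
    then show ?thesis
    proof eventually_elim
      case (elim t)
      have "(\<integral>x. D (r k) x \<partial>M t) \<le> (\<integral>x. f x \<partial>M t)"
        using iD[OF M] int[OF M f(1) fB] r by (intro integral_mono) auto
      with elim k show ?case by linarith
    qed
  qed
  note fi = int[OF _ _ f]
  have B1: "(\<integral>x. B + f x \<partial>N) = B + (\<integral>x. f x \<partial>N)" "(\<integral>x. B - f x \<partial>N) = B - (\<integral>x. f x \<partial>N)"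
    if "prob_space N" "sets N = sets borel" for N
  proof -
    interpret prob_space N by fact
    show "(\<integral>x. B + f x \<partial>N) = B + (\<integral>x. f x \<partial>N)" "(\<integral>x. B - f x \<partial>N) = B - (\<integral>x. f x \<partial>N)"
      using fi[OF that] prob_space by auto
  qed
  have fb: "- B \<le> f x" "f x \<le> B" for x using f(2)[of x] by auto
  show ?thesis
  proof (rule tendstoI)
    fix \<epsilon> :: real assume \<epsilon>: "\<epsilon> > 0"
    have fb': "0 \<le> B + f x" "B + f x \<le> 2 * B" "0 \<le> B - f x" "B - f x \<le> 2 * B" for x
      using fb[of x] by auto
    have "eventually (\<lambda>t. (\<integral>x. B + f x \<partial>\<mu>) - \<epsilon> < (\<integral>x. B + f x \<partial>M t)) F"
      by (rule lower[OF _ fb'(1,2) \<epsilon>]) (intro continuous_intros f(1))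
    moreover have "eventually (\<lambda>t. (\<integral>x. B - f x \<partial>\<mu>) - \<epsilon> < (\<integral>x. B - f x \<partial>M t)) F"
      by (rule lower[OF _ fb'(3,4) \<epsilon>]) (intro continuous_intros f(1))
    ultimately show "eventually (\<lambda>t. dist (\<integral>x. f x \<partial>M t) (\<integral>x. f x \<partial>\<mu>) < \<epsilon>) F"
      by eventually_elim (simp add: B1 M \<mu> dist_real_def abs_less_iff)
  qed
qed

section \<open>The mean ergodic theorem for continuous flows\<close>

text \<open>The difference of the two sides is the variance.\<close>

lemma (in prob_space) square_expectation_le:
  fixes X :: "'a \<Rightarrow> real"
  assumes "X \<in> borel_measurable M" "\<And>x. \<bar>X x\<bar> \<le> B"
  shows "(expectation X)\<^sup>2 \<le> expectation (\<lambda>x. (X x)\<^sup>2)"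
proof -
  have i1: "integrable M X" using assms by (intro integrable_prob_bounded[OF prob_space_axioms]) auto
  have "\<bar>(X x)\<^sup>2\<bar> \<le> B\<^sup>2" for x using power_mono[OF assms(2)[of x], of 2] by simp
  then have i2: "integrable M (\<lambda>x. (X x)\<^sup>2)"
    using assms(1) by (intro integrable_prob_bounded[OF prob_space_axioms, where B="B\<^sup>2"]) auto
  show ?thesis using variance_positive[of X] variance_eq[OF i1 i2] by simp
qed

locale continuous_flow =
  fixes \<phi> :: "real \<Rightarrow> 'a::{second_countable_topology, t2_space} \<Rightarrow> 'a"
  assumes continuous_flow: "continuous_on UNIV (\<lambda>(s, x). \<phi> s x)"
    and flow_add: "\<phi> (s + t) x = \<phi> s (\<phi> t x)"
    and flow_zero: "\<phi> 0 x = x"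
begin

lemma flow_uminus: "\<phi> (- s) (\<phi> s x) = x"
  using flow_add[of "-s" s x] by (simp add: flow_zero)

lemma continuous_flow_time: "continuous_on UNIV (\<phi> s)"
proof -
  have "continuous_on UNIV (\<lambda>x::'a. (s, x))" by (intro continuous_intros)
  from continuous_on_compose2[OF continuous_flow this] show ?thesis by simp
qed

text \<open>By second countability the Borel sets of the product form the product \<sigma>-algebra,
  so joint continuity gives the joint measurability that Fubini's theorem requires.\<close>

lemma measurable_flow_pair: "(\<lambda>(s, x). \<phi> s x) \<in> borel_measurable (borel \<Otimes>\<^sub>M borel)"
  using borel_measurable_continuous_onI[OF continuous_flow] by (simp add: borel_prod)

lemma measurable_flow [measurable (raw)]:
  "f \<in> borel_measurable N \<Longrightarrow> g \<in> borel_measurable N \<Longrightarrow> (\<lambda>y. \<phi> (f y) (g y)) \<in> borel_measurable N"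
  using measurable_compose[OF measurable_Pair measurable_flow_pair, of f N g] by simp

lemma Cc_flow:
  assumes "f \<in> Cc"
  shows "(\<lambda>x. f (\<phi> s x)) \<in> Cc"
proof (rule CcI)
  show "continuous_on UNIV (\<lambda>x. f (\<phi> s x))"
    using continuous_on_compose2[OF Cc_continuous[OF assms] continuous_flow_time] by simp
  show "compact (\<phi> (- s) ` closure {x. f x \<noteq> 0})"
    using assms by (intro compact_continuous_image Cc_compact) 
      (auto intro: continuous_on_subset[OF continuous_flow_time])
  fix x assume x: "x \<notin> \<phi> (- s) ` closure {x. f x \<noteq> 0}"
  have "\<phi> s x \<notin> closure {x. f x \<noteq> 0}"
  proof
    assume "\<phi> s x \<in> closure {x. f x \<noteq> 0}"
    from imageI[OF this, of "\<phi> (- s)"] x show False by (simp add: flow_uminus)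
  qed
  then show "f (\<phi> s x) = 0" by (rule Cc_eq_0)
qed

text \<open>Finite averages of \<open>f\<close> along orbits; closure under midpoints is all the convexity
  that the parallelogram law needs.\<close>

inductive_set midhull :: "('a \<Rightarrow> real) \<Rightarrow> ('a \<Rightarrow> real) set" for f where
  base: "f \<in> midhull f"
| shift: "F \<in> midhull f \<Longrightarrow> (\<lambda>x. F (\<phi> s x)) \<in> midhull f"
| mid: "F \<in> midhull f \<Longrightarrow> G \<in> midhull f \<Longrightarrow> (\<lambda>x. (F x + G x) / 2) \<in> midhull f"

lemma midhull_Cc: "F \<in> midhull f \<Longrightarrow> f \<in> Cc \<Longrightarrow> F \<in> Cc"
  by (induction rule: midhull.induct) (auto intro: Cc_flow Cc_midpoint)

lemma midhull_bounded:
  assumes "F \<in> midhull f" "\<And>x. \<bar>f x\<bar> \<le> B"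
  shows "\<bar>F x\<bar> \<le> B"
  using assms(1)
proof (induction arbitrary: x rule: midhull.induct)
  case (mid F G)
  have "\<bar>F x\<bar> \<le> B" "\<bar>G x\<bar> \<le> B" by (rule mid.IH)+
  then have "\<bar>F x + G x\<bar> \<le> 2 * B" by linarith
  then show ?case by simp
qed (use assms in auto)

section \<open>Invariant sets, invariant functions and orbit averages for an ergodic measure\<close>

context
  fixes \<mu> :: "'a measure"
  assumes ergodic: "flow_ergodic \<phi> \<mu>"
begin

lemma ergodic_prob_space: "prob_space \<mu>" and sets_ergodic [measurable_cong]: "sets \<mu> = sets borel"
  and distr_flow: "distr \<mu> borel (\<phi> s) = \<mu>"
  using ergodic by (simp_all add: flow_ergodic_def push_def)

lemma integral_flow:
  fixes F :: "'a \<Rightarrow> real"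
  assumes "F \<in> borel_measurable borel"
  shows "(\<integral>x. F (\<phi> s x) \<partial>\<mu>) = (\<integral>x. F x \<partial>\<mu>)"
proof -
  have "(\<integral>x. F x \<partial>\<mu>) = (\<integral>x. F x \<partial>distr \<mu> borel (\<phi> s))" by (simp add: distr_flow)
  also have "\<dots> = (\<integral>x. F (\<phi> s x) \<partial>\<mu>)"
    using assms by (intro integral_distr) (auto)
  finally show ?thesis ..
qed

lemma AE_flow: "AE x in \<mu>. P x \<Longrightarrow> AE x in \<mu>. P (\<phi> s x)"
  using AE_distrD[of "\<phi> s" \<mu> borel P, unfolded distr_flow] by simp

text \<open>The strictly invariant set is the set of points whose orbit lies in \<open>A\<close> at almost every time;
  by Fubini's theorem it agrees with \<open>A\<close> up to a null set.\<close>

lemma AE_invariant_set: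
  assumes A [measurable]: "A \<in> sets borel" and inv: "\<And>s. AE x in \<mu>. \<phi> s x \<in> A \<longleftrightarrow> x \<in> A"
  shows "measure \<mu> A = 0 \<or> measure \<mu> A = 1"
proof -
  interpret prob_space \<mu> by (rule ergodic_prob_space)
  interpret pair_sigma_finite \<mu> lborel ..
  define A' where "A' = {x. AE s in lborel. \<phi> s x \<in> A}"
  \<comment> \<open>Written as the zero set of a parameter integral, \<open>A'\<close> is seen to be
    Borel.\<close>
  have "A' = {x. (\<integral>\<^sup>+s. indicator (- A) (\<phi> s x) \<partial>lborel) = 0}"
  proof -
    have "(AE s in lborel. \<phi> s x \<in> A) \<longleftrightarrow> (\<integral>\<^sup>+s. indicator (- A) (\<phi> s x) \<partial>lborel) = 0" for x
      by (subst nn_integral_0_iff_AE) (auto simp: indicator_def)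
    then show ?thesis by (simp add: A'_def)
  qed
  also have "\<dots> \<in> sets borel" by measurable
  finally have A'm [measurable]: "A' \<in> sets borel" .
  have "\<phi> u -` A' = A'" for u
  proof -
    \<comment> \<open>Translation invariance of Lebesgue measure makes \<open>A'\<close> invariant
      at every point, as the definition of \<open>flow_ergodic\<close> demands.\<close>
    have "(AE s in lborel. \<phi> s (\<phi> u x) \<in> A) \<longleftrightarrow> (AE s in lborel. \<phi> s x \<in> A)" for x
    proof -
      have "(AE s in lborel. \<phi> s x \<in> A) \<longleftrightarrow> (AE s in distr lborel borel ((+) u). \<phi> s x \<in> A)"
        unfolding lborel_distr_plus ..
      also have "\<dots> \<longleftrightarrow> (AE s in lborel. \<phi> (u + s) x \<in> A)"
        by (subst AE_distr_iff) auto
      finally show ?thesis using flow_add by (simp add: add.commute)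
    qed
    then show ?thesis by (auto simp: A'_def)
  qed
  then have "measure \<mu> A' = 0 \<or> measure \<mu> A' = 1"
    using ergodic A'm unfolding flow_ergodic_def by blast
  moreover have "measure \<mu> A = measure \<mu> A'"
  proof (rule measure_eq_AE)
    have "AE s in lborel. AE x in \<mu>. \<phi> s x \<in> A \<longleftrightarrow> x \<in> A" using inv by simp
    moreover have "Measurable.pred (\<mu> \<Otimes>\<^sub>M lborel) (\<lambda>p. \<phi> (snd p) (fst p) \<in> A \<longleftrightarrow> fst p \<in> A)"
      by measurable
    ultimately have "AE x in \<mu>. AE s in lborel. \<phi> s x \<in> A \<longleftrightarrow> x \<in> A"
      by (subst AE_commute) (simp_all add: pred_def)
    then show "AE x in \<mu>. x \<in> A \<longleftrightarrow> x \<in> A'"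
    proof eventually_elim
      case (elim x)
      show ?case
      proof (cases "x \<in> A")
        case True then show ?thesis using elim by (simp add: A'_def)
      next
        case False
        then have "AE s in lborel. \<phi> s x \<notin> A" using elim by simp
        then have "\<not> (AE s in lborel. \<phi> s x \<in> A)"
        proof (intro notI)
          assume "AE s in lborel. \<phi> s x \<notin> A" "AE s in lborel. \<phi> s x \<in> A"
          then have "AE s in (lborel :: real measure). False" by eventually_elim auto
          then have "emeasure lborel (UNIV :: real set) = 0"
            by (subst (asm) AE_iff_measurable[OF _ refl]) auto
          then show False by simp
        qed
        then show ?thesis using False by (simp add: A'_def)
      qed
    qed
  qed auto
  ultimately show ?thesis by simp
qed

text \<open>Preimages of Borel sets under \<open>g\<close> are invariant up to null sets, hence null
  or of full measure. Neither \<open>g > c\<close> nor \<open>g < c\<close> can hold almost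
  everywhere when \<open>c\<close> is the mean, so both sets are null.\<close>

lemma AE_invariant_const:
  fixes g :: "'a \<Rightarrow> real"
  assumes g [measurable]: "g \<in> borel_measurable borel" and B: "\<And>x. \<bar>g x\<bar> \<le> B"
    and inv: "\<And>s. AE x in \<mu>. g (\<phi> s x) = g x"
  shows "AE x in \<mu>. g x = (\<integral>x. g x \<partial>\<mu>)"
proof -
  interpret prob_space \<mu> by (rule ergodic_prob_space)
  define c where "c = (\<integral>x. g x \<partial>\<mu>)"
  have int: "integrable \<mu> g" using B by (intro integrable_prob_bounded[OF prob_space_axioms]) auto
  have *: "AE x in \<mu>. g x \<notin> S" if S [measurable]: "S \<in> sets borel" and ne: "\<not> (AE x in \<mu>. g x \<in> S)" for S
  proof -
    have "measure \<mu> {x. g x \<in> S} = 0 \<or> measure \<mu> {x. g x \<in> S} = 1"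
    proof (rule AE_invariant_set)
      show "AE x in \<mu>. \<phi> s x \<in> {x. g x \<in> S} \<longleftrightarrow> x \<in> {x. g x \<in> S}" for s
        using inv[of s] by eventually_elim simp
    qed measurable
    moreover have "measure \<mu> {x. g x \<in> S} \<noteq> 1"
      using ne prob_eq_1[of "{x. g x \<in> S}"] by simp
    ultimately show ?thesis using prob_eq_0[of "{x. g x \<in> S}"] by simp
  qed
  have "AE x in \<mu>. g x \<notin> {c<..}"
  proof (rule *)
    show "\<not> (AE x in \<mu>. g x \<in> {c<..})" using expectation_greater[OF int, of c] by (auto simp: c_def)
  qed simp
  moreover have "AE x in \<mu>. g x \<notin> {..<c}"
  proof (rule *)
    show "\<not> (AE x in \<mu>. g x \<in> {..<c})" using expectation_less[OF int, of c] by (auto simp: c_def)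
  qed simp
  ultimately show ?thesis unfolding c_def[symmetric] by eventually_elim auto
qed

lemma midhull_integral:
  assumes "F \<in> midhull f" and f: "f \<in> Cc"
  shows "(\<integral>x. F x \<partial>\<mu>) = (\<integral>x. f x \<partial>\<mu>)"
  using assms(1)
proof (induction rule: midhull.induct)
  case (shift F s)
  have [measurable]: "F \<in> Cc" using shift.hyps f by (rule midhull_Cc)
  show ?case using shift.IH by (subst integral_flow) auto
next
  case (mid F G)
  have int: "integrable \<mu> H" if "H \<in> midhull f" for H
  proof -
    have H [measurable]: "H \<in> Cc" using that f by (rule midhull_Cc)
    obtain B where "\<And>x. \<bar>H x\<bar> \<le> B" using Cc_bounded[OF H] by blast
    then show ?thesis by (intro integrable_prob_bounded[OF ergodic_prob_space, where B=B]) auto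
  qed
  show ?case using int[OF mid.hyps(1)] int[OF mid.hyps(2)] mid.IH by simp
qed simp

text \<open>The mean ergodic theorem by minimal norm: near-minimizers of the \<open>L^2\<close> norm
  on \<open>midhull f\<close> form a Cauchy sequence. Translation maps the hull into itself and
  preserves the norm, so the limit is invariant and therefore constant; comparing integrals
  identifies the constant.\<close>

lemma midhull_approximates_mean:
  assumes f: "f \<in> Cc" and \<epsilon>: "\<epsilon> > 0"
  obtains F where "F \<in> midhull f" "(\<integral>x. (F x - (\<integral>y. f y \<partial>\<mu>))\<^sup>2 \<partial>\<mu>) < \<epsilon>"
proof -
  interpret prob_space \<mu> by (rule ergodic_prob_space)
  obtain B where B0: "B \<ge> 0" and fB: "\<And>x. \<bar>f x\<bar> \<le> B" using Cc_bounded[OF f] by blast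
  have HB: "\<bar>F x\<bar> \<le> B" if "F \<in> midhull f" for F x using that fB by (rule midhull_bounded)
  have Hm: "F \<in> borel_measurable borel" if "F \<in> midhull f" for F
    using midhull_Cc[OF that f] by measurable
  have int: "integrable \<mu> F" if "F \<in> borel_measurable borel" "\<And>x. \<bar>F x\<bar> \<le> C" for F :: "'a \<Rightarrow> real" and C
    using that by (intro integrable_prob_bounded[OF prob_space_axioms, where B=C]) (auto cong: measurable_cong_sets)
  have sq: "\<bar>(a - b)\<^sup>2\<bar> \<le> (2 * B)\<^sup>2" "\<bar>(a + b)\<^sup>2\<bar> \<le> (2 * B)\<^sup>2" if "\<bar>a\<bar> \<le> B" "\<bar>b\<bar> \<le> B" for a b
    using power_mono[of "\<bar>a - b\<bar>" "2 * B" 2] power_mono[of "\<bar>a + b\<bar>" "2 * B" 2] that by auto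
  define N where "N F = (\<integral>x. (F x)\<^sup>2 \<partial>\<mu>)" for F :: "'a \<Rightarrow> real"
  define m where "m = (INF F\<in>midhull f. N F)"
  have N0: "0 \<le> N F" for F unfolding N_def by simp
  have bdd: "bdd_below (N ` midhull f)" using N0 by (intro bdd_belowI[of _ 0]) auto
  have mN: "m \<le> N F" if "F \<in> midhull f" for F unfolding m_def using bdd that by (rule cINF_lower)
  \<comment> \<open>The parallelogram law: the midpoint of \<open>F\<close> and \<open>G\<close>
    lies in the hull, so its squared norm is at least \<open>m\<close>.\<close>
  have dist: "(\<integral>x. (F x - G x)\<^sup>2 \<partial>\<mu>) \<le> 2 * N F + 2 * N G - 4 * m"
    if F: "F \<in> midhull f" and G: "G \<in> midhull f" for F G
  proof -
    note [measurable] = Hm[OF F] Hm[OF G]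
    have i: "integrable \<mu> (\<lambda>x. (F x)\<^sup>2)" "integrable \<mu> (\<lambda>x. (G x)\<^sup>2)"
      "integrable \<mu> (\<lambda>x. (F x + G x)\<^sup>2)"
      using sq(1)[OF HB[OF F], of 0] sq(1)[OF HB[OF G], of 0] sq(2)[OF HB[OF F] HB[OF G]] B0
      by (auto intro!: int[of _ "(2 * B)\<^sup>2"])
    have "(\<integral>x. (F x - G x)\<^sup>2 \<partial>\<mu>) = (\<integral>x. 2 * (F x)\<^sup>2 + 2 * (G x)\<^sup>2 - (F x + G x)\<^sup>2 \<partial>\<mu>)"
      by (intro Bochner_Integration.integral_cong) (auto simp: power2_eq_square algebra_simps)
    also have "\<dots> = 2 * N F + 2 * N G - (\<integral>x. (F x + G x)\<^sup>2 \<partial>\<mu>)"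
      using i by (simp add: N_def)
    also have "(\<integral>x. (F x + G x)\<^sup>2 \<partial>\<mu>) = 4 * N (\<lambda>x. (F x + G x) / 2)"
      by (simp add: N_def power_divide)
    finally show ?thesis using mN[OF midhull.mid[OF F G]] by simp
  qed
  have "\<exists>F\<in>midhull f. N F < m + inverse (Suc n)" for n
  proof -
    have "m < m + inverse (Suc n)" by simp
    then show ?thesis unfolding m_def using cINF_less_iff[OF _ bdd] midhull.base by blast
  qed
  then obtain F where F: "\<And>n. F n \<in> midhull f" and FN: "\<And>n. N (F n) < m + inverse (Suc n)" by metis
  note [measurable] = Hm[OF F]
  \<comment> \<open>The almost everywhere convergent subsequence is extracted in \<open>L^1\<close>;
    on a probability space \<open>L^2\<close> distances dominate \<open>L^1\<close>
    distances.\<close>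
  have L1: "\<exists>K. \<forall>i\<ge>K. \<forall>j\<ge>K. (\<integral>x. norm (F i x - F j x) \<partial>\<mu>) < e" if e: "e > 0" for e
  proof -
    obtain K where K: "inverse (real (Suc K)) < e\<^sup>2 / 4" using reals_Archimedean[of "e\<^sup>2/4"] e by auto
    show ?thesis
    proof (intro exI allI impI)
      fix i j assume ij: "i \<ge> K" "j \<ge> K"
      have "inverse (real (Suc i)) \<le> inverse (Suc K)" "inverse (real (Suc j)) \<le> inverse (Suc K)"
        using ij by (auto intro!: le_imp_inverse_le)
      then have lt: "(\<integral>x. (F i x - F j x)\<^sup>2 \<partial>\<mu>) < e\<^sup>2" 
        using dist[OF F F, of i j] FN[of i] FN[of j] K by linarith
      have "\<bar>\<bar>F i x - F j x\<bar>\<bar> \<le> 2 * B" for x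
        using HB[OF F, of i x] HB[OF F, of j x] by linarith
      then have "(\<integral>x. \<bar>F i x - F j x\<bar> \<partial>\<mu>)\<^sup>2 \<le> (\<integral>x. \<bar>F i x - F j x\<bar>\<^sup>2 \<partial>\<mu>)"
        by (intro square_expectation_le) auto
      with lt have "(\<integral>x. \<bar>F i x - F j x\<bar> \<partial>\<mu>)\<^sup>2 < e\<^sup>2" by simp
      then show "(\<integral>x. norm (F i x - F j x) \<partial>\<mu>) < e" using e by (simp add: power_less_imp_less_base)
    qed
  qed
  obtain r where r: "strict_mono r" "AE x in \<mu>. Cauchy (\<lambda>i. F (r i) x)"
    using cauchy_L1_AE_cauchy_subseq[of \<mu> F, OF int[OF Hm[OF F] HB[OF F]] L1] by blast
  \<comment> \<open>The value of \<open>lim\<close> is arbitrary where the sequence diverges.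
    Clamping bounds \<open>g\<close> everywhere and changes nothing at points of
    convergence.\<close>
  define g where "g x = max (- B) (min B (lim (\<lambda>i. F (r i) x)))" for x
  have gm [measurable]: "g \<in> borel_measurable borel" unfolding g_def by measurable
  have gB: "\<bar>g x\<bar> \<le> B" for x using B0 by (auto simp: g_def)
  have conv: "AE x in \<mu>. (\<lambda>i. F (r i) x) \<longlonglongrightarrow> g x"
    using r(2)
  proof eventually_elim
    case (elim x)
    then have "(\<lambda>i. F (r i) x) \<longlonglongrightarrow> lim (\<lambda>i. F (r i) x)"
      by (simp add: Cauchy_convergent convergent_LIMSEQ_iff[symmetric])
    then have "(\<lambda>i. max (- B) (min B (F (r i) x))) \<longlonglongrightarrow> g x"
      unfolding g_def by (intro tendsto_intros)
    moreover have "max (- B) (min B (F (r i) x)) = F (r i) x" for i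
      using HB[OF F, of "r i" x] by auto
    ultimately show ?case by simp
  qed
  \<comment> \<open>This is the bound from \<open>dist\<close> for a member of the hull and its
    translate, which have equal norms.\<close>
  have Nlim: "(\<lambda>i. 4 * (N (F (r i)) - m)) \<longlonglongrightarrow> 0"
  proof (rule tendsto_sandwich[of "\<lambda>_. 0" _ _ "\<lambda>i. 4 * inverse (real (Suc (r i)))"])
    have "(\<lambda>i. 4 * inverse (real (Suc (r i)))) \<longlonglongrightarrow> 4 * 0"
      using LIMSEQ_subseq_LIMSEQ[OF LIMSEQ_inverse_real_of_nat r(1)] 
      by (intro tendsto_mult tendsto_const) (simp add: o_def)
    then show "(\<lambda>i. 4 * inverse (real (Suc (r i)))) \<longlonglongrightarrow> 0" by simp
    show "eventually (\<lambda>i. 4 * (N (F (r i)) - m) \<le> 4 * inverse (real (Suc (r i)))) sequentially"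
    proof (intro always_eventually allI)
      fix i
      have "N (F (r i)) - m \<le> inverse (real (Suc (r i)))"
        using less_imp_le[OF FN[of "r i"]] by (simp only: diff_le_eq add.commute)
      then show "4 * (N (F (r i)) - m) \<le> 4 * inverse (real (Suc (r i)))"
        by (rule mult_left_mono) simp
    qed
  qed (use mN[OF F] in auto)
  have "AE x in \<mu>. g (\<phi> s x) = g x" for s
  proof -
    have "(\<lambda>i. \<integral>x. (F (r i) (\<phi> s x) - F (r i) x)\<^sup>2 \<partial>\<mu>) \<longlonglongrightarrow> (\<integral>x. (g (\<phi> s x) - g x)\<^sup>2 \<partial>\<mu>)"
    proof (rule integral_dominated_convergence[where w="\<lambda>_. (2 * B)\<^sup>2"])
      show "AE x in \<mu>. (\<lambda>i. (F (r i) (\<phi> s x) - F (r i) x)\<^sup>2) \<longlonglongrightarrow> (g (\<phi> s x) - g x)\<^sup>2"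
        using conv AE_flow[OF conv, of s] by eventually_elim (intro tendsto_intros)
      show "AE x in \<mu>. norm ((F (r i) (\<phi> s x) - F (r i) x)\<^sup>2) \<le> (2 * B)\<^sup>2" for i
        using sq(1)[OF HB[OF F] HB[OF F]] by simp
    qed auto
    moreover have "(\<lambda>i. \<integral>x. (F (r i) (\<phi> s x) - F (r i) x)\<^sup>2 \<partial>\<mu>) \<longlonglongrightarrow> 0"
    proof (rule tendsto_sandwich[OF _ _ tendsto_const Nlim])
      have "(\<integral>x. (F n (\<phi> s x) - F n x)\<^sup>2 \<partial>\<mu>) \<le> 4 * (N (F n) - m)" for n
      proof -
        have "N (\<lambda>x. F n (\<phi> s x)) = N (F n)"
          unfolding N_def by (rule integral_flow) measurable
        then show ?thesis using dist[OF midhull.shift[OF F] F, of n s n] by simp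
      qed
      then show "eventually (\<lambda>i. (\<integral>x. (F (r i) (\<phi> s x) - F (r i) x)\<^sup>2 \<partial>\<mu>) \<le> 4 * (N (F (r i)) - m)) sequentially"
        by simp
    qed simp
    ultimately have "(\<integral>x. (g (\<phi> s x) - g x)\<^sup>2 \<partial>\<mu>) = 0" by (rule LIMSEQ_unique)
    moreover have "integrable \<mu> (\<lambda>x. (g (\<phi> s x) - g x)\<^sup>2)"
      by (rule int[OF _ sq(1)[OF gB gB]]) measurable
    ultimately have "AE x in \<mu>. (g (\<phi> s x) - g x)\<^sup>2 = 0"
      by (subst (asm) integral_nonneg_eq_0_iff_AE) auto
    then show ?thesis by simp
  qed
  from AE_invariant_const[OF gm gB this] have gconst: "AE x in \<mu>. g x = (\<integral>x. g x \<partial>\<mu>)" .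
  have "(\<lambda>i. \<integral>x. F (r i) x \<partial>\<mu>) \<longlonglongrightarrow> (\<integral>x. g x \<partial>\<mu>)"
    by (rule integral_dominated_convergence[where w="\<lambda>_. B", OF _ _ _ conv]) (use HB[OF F] in auto)
  \<comment> \<open>All members of the hull have the same integral as \<open>f\<close>, so the
    convergent sequence of integrals is constant.\<close>
  then have gc: "(\<integral>x. g x \<partial>\<mu>) = (\<integral>x. f x \<partial>\<mu>)"
    using midhull_integral[OF F f] by (simp add: LIMSEQ_const_iff)
  define c where "c = (\<integral>x. f x \<partial>\<mu>)"
  have cB: "\<bar>c\<bar> \<le> B"
  proof -
    have "\<bar>c\<bar> \<le> (\<integral>x. \<bar>f x\<bar> \<partial>\<mu>)" unfolding c_def by (rule integral_abs_bound)
    also have "\<dots> \<le> B"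
    proof (rule integral_le_const)
      show "integrable \<mu> (\<lambda>x. \<bar>f x\<bar>)" 
        using int[OF Hm[OF midhull.base] fB] by (rule integrable_abs)
    qed (use fB in auto)
    finally show ?thesis .
  qed
  have "(\<lambda>i. \<integral>x. (F (r i) x - c)\<^sup>2 \<partial>\<mu>) \<longlonglongrightarrow> (\<integral>x. 0 \<partial>\<mu>)"
  proof (rule integral_dominated_convergence[where w="\<lambda>_. (2 * B)\<^sup>2"])
    show "AE x in \<mu>. (\<lambda>i. (F (r i) x - c)\<^sup>2) \<longlonglongrightarrow> 0"
      using conv gconst
    proof eventually_elim
      case (elim x)
      then have "(\<lambda>i. (F (r i) x - c)\<^sup>2) \<longlonglongrightarrow> (c - c)\<^sup>2"
        by (intro tendsto_intros) (simp add: gc c_def)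
      then show ?case by simp
    qed
    show "AE x in \<mu>. norm ((F (r i) x - c)\<^sup>2) \<le> (2 * B)\<^sup>2" for i
      using sq(1)[OF HB[OF F] cB] by simp
  qed auto
  then have "eventually (\<lambda>i. (\<integral>x. (F (r i) x - c)\<^sup>2 \<partial>\<mu>) < \<epsilon>) sequentially"
    using \<epsilon> by (intro order_tendstoD(2)[of _ 0]) auto
  then obtain i where "(\<integral>x. (F (r i) x - c)\<^sup>2 \<partial>\<mu>) < \<epsilon>" by (auto simp: eventually_sequentially)
  then show ?thesis using that[OF F] by (simp add: c_def)
qed

end

end

section \<open>Actions of the special linear group\<close>

abbreviation mat22 :: "real \<Rightarrow> real \<Rightarrow> real \<Rightarrow> real \<Rightarrow> real^2^2" where
  "mat22 a b c d \<equiv> vector [vector [a, b], vector [c, d]]"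

lemma mat22_eq_iff:
  fixes A B :: "real^2^2"
  shows "A = B \<longleftrightarrow> A$1$1 = B$1$1 \<and> A$1$2 = B$1$2 \<and> A$2$1 = B$2$1 \<and> A$2$2 = B$2$2"
  by (auto simp: vec_eq_iff forall_2)

lemma mat22_mult:
  "mat22 a b c d ** mat22 a' b' c' d' =
     mat22 (a * a' + b * c') (a * b' + b * d') (c * a' + d * c') (c * b' + d * d')"
  by (simp add: mat22_eq_iff matrix_matrix_mult_def sum_2)

lemma mat22_one: "mat 1 = mat22 1 0 0 1"
  by (simp add: mat22_eq_iff mat_def)

lemma tendsto_mat22:
  assumes "((\<lambda>t. A t$1$1) \<longlongrightarrow> B$1$1) F" "((\<lambda>t. A t$1$2) \<longlongrightarrow> B$1$2) F"
    "((\<lambda>t. A t$2$1) \<longlongrightarrow> B$2$1) F" "((\<lambda>t. A t$2$2) \<longlongrightarrow> B$2$2) F"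
  shows "(A \<longlongrightarrow> (B :: real^2^2)) F"
proof (rule vec_tendstoI, rule vec_tendstoI)
  show "((\<lambda>t. A t $ i $ j) \<longlongrightarrow> B $ i $ j) F" for i j
    using assms exhaust_2[of i] exhaust_2[of j] by auto
qed

lemma continuous_on_mat22:
  assumes "continuous_on S a" "continuous_on S b" "continuous_on S c" "continuous_on S d"
  shows "continuous_on S (\<lambda>t. mat22 (a t) (b t) (c t) (d t))"
  using assms unfolding continuous_on_def by (auto intro!: tendsto_mat22)

text \<open>The adjugate: an inverse in determinant \<open>1\<close> whose continuity is evident,
  because it is linear in the entries.\<close>

definition adj22 :: "real^2^2 \<Rightarrow> real^2^2" where
  "adj22 A = mat22 (A$2$2) (- A$1$2) (- A$2$1) (A$1$1)"

lemma adj22_mult: "det A = 1 \<Longrightarrow> adj22 A ** A = mat 1"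
  by (auto simp: adj22_def mat22_eq_iff det_2 matrix_matrix_mult_def sum_2 mat_def algebra_simps)

lemma det_adj22: "det (adj22 A) = det A"
  by (simp add: adj22_def det_2)

lemma tendsto_adj22: "(A \<longlongrightarrow> mat 1) F \<Longrightarrow> ((\<lambda>t. adj22 (A t)) \<longlongrightarrow> mat 1) F"
  by (rule tendsto_mat22) (auto simp: adj22_def mat_def intro!: tendsto_eq_intros)

lemma SL2R_simps: "carrier SL2R = {A. det A = 1}" "A \<otimes>\<^bsub>SL2R\<^esub> B = A ** B" "\<one>\<^bsub>SL2R\<^esub> = mat 1"
  by (simp_all add: SL2R_def)

lemma det_geo [simp]: "det (geo t) = 1"
  by (simp add: geo_def det_2 flip: exp_add)

lemma det_horo [simp]: "det (horo t) = 1"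
  by (simp add: horo_def det_2)

lemma det_rot [simp]: "det (rot t) = 1"
  using sin_cos_squared_add3[of t] by (simp add: rot_def det_2 algebra_simps)

lemma continuous_on_geo: "continuous_on UNIV geo"
  unfolding geo_def[abs_def] by (intro continuous_on_mat22 continuous_intros)

lemma continuous_on_horo: "continuous_on UNIV horo"
  unfolding horo_def[abs_def] by (intro continuous_on_mat22 continuous_intros)

lemma continuous_on_rot: "continuous_on UNIV rot"
  unfolding rot_def[abs_def] by (intro continuous_on_mat22 continuous_intros)

lemma horo_add: "horo (s + t) = horo s ** horo t"
  by (simp add: horo_def mat22_mult algebra_simps)

lemma rot_add: "rot (s + t) = rot s ** rot t"
  by (simp add: rot_def mat22_mult cos_add sin_add algebra_simps)

lemma geo_mult_geo_uminus: "geo t ** geo (- t) = mat 1" "geo (- t) ** geo t = mat 1"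
  by (simp_all add: geo_def mat22_mult mat22_one flip: exp_add)

text \<open>This relation is the expansion of horocycles: a displacement of fixed size at time
  \<open>t\<close> goes back to one shrunk by \<open>exp (- 2 * t)\<close> at time
  \<open>0\<close>.\<close>

lemma horo_mult_geo: "horo r ** geo t = geo t ** horo (r * exp (- 2 * t))"
proof -
  have "exp (- t) = exp t * exp (- (t * 2))" by (simp flip: exp_add)
  then show ?thesis by (simp add: horo_def geo_def mat22_mult mat22_eq_iff mult_ac)
qed

lemma horo_zero: "horo 0 = mat 1"
  by (simp add: horo_def mat22_one)

section \<open>Averages over arcs and over time\<close>

lemma integral_unif:
  fixes k :: "real \<Rightarrow> real"
  assumes "L > 0" and k [measurable]: "k \<in> borel_measurable borel"
  shows "(\<integral>s. k s \<partial>unif L) = (\<integral>s. indicator {0..L} s * k s \<partial>lborel) / L"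
proof -
  have "unif L = density lborel (\<lambda>s. ennreal (indicator {0..L} s / L))"
    unfolding uniform_measure_def using assms
    by (intro density_cong) (auto simp: divide_ennreal indicator_def simp flip: ennreal_1 simp del: ennreal_1)
  then have "(\<integral>s. k s \<partial>unif L) = (\<integral>s. (indicator {0..L} s / L) * k s \<partial>lborel)"
    using assms by (simp add: integral_density)
  then show ?thesis by simp
qed

text \<open>Shifting the interval of integration matters only near its two endpoints, on a set of
  length at most \<open>4 * \<bar>\<alpha>\<bar>\<close>.\<close>

lemma integral_unif_shift_le:
  fixes k :: "real \<Rightarrow> real"
  assumes L: "L > 0" and k [measurable]: "k \<in> borel_measurable borel" and B: "\<And>s. \<bar>k s\<bar> \<le> B"
  shows "\<bar>(\<integral>s. k (s + \<alpha>) \<partial>unif L) - (\<integral>s. k s \<partial>unif L)\<bar> \<le> 4 * B * \<bar>\<alpha>\<bar> / L"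
proof -
  have fin: "integrable lborel (\<lambda>s. indicator {u..v} s * k s)" for u v
  proof (rule Bochner_Integration.integrable_bound[where f="\<lambda>s. B * indicator {u..v} s"])
    show "AE s in lborel. norm (indicator {u..v} s * k s) \<le> norm (B * indicator {u..v} s)"
      using B by (auto simp: indicator_def intro: order_trans[OF _ abs_ge_self])
  qed (auto intro!: integrable_mult_right integrable_real_indicator simp: emeasure_lborel_Icc_eq)
  \<comment> \<open>Windows of radius \<open>\<bar>\<alpha>\<bar>\<close> around \<open>0\<close>
    and \<open>L\<close> cover the symmetric difference of the two intervals for either sign of
    \<alpha>, even when \<open>\<bar>\<alpha>\<bar>\<close> exceeds \<open>L\<close>.\<close>
  define I where "I s = indicat_real {- \<bar>\<alpha>\<bar>..\<bar>\<alpha>\<bar>} s + indicat_real {L - \<bar>\<alpha>\<bar>..L + \<bar>\<alpha>\<bar>} s" for s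
  have I: "integrable lborel I" unfolding I_def by auto
  have "(\<integral>s. indicator {\<alpha>..L + \<alpha>} s * k s \<partial>lborel) =
      \<bar>1\<bar> *\<^sub>R (\<integral>s. indicator {\<alpha>..L + \<alpha>} (\<alpha> + 1 * s) * k (\<alpha> + 1 * s) \<partial>lborel)"
    by (rule lborel_integral_real_affine) simp
  also have "\<dots> = (\<integral>s. indicator {0..L} s * k (s + \<alpha>) \<partial>lborel)"
    by (auto intro!: Bochner_Integration.integral_cong simp: indicator_def add.commute)
  finally have "(\<integral>s. indicator {0..L} s * k (s + \<alpha>) \<partial>lborel) = (\<integral>s. indicator {\<alpha>..L + \<alpha>} s * k s \<partial>lborel)" ..
  then have "(\<integral>s. k (s + \<alpha>) \<partial>unif L) - (\<integral>s. k s \<partial>unif L) =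
      ((\<integral>s. indicator {\<alpha>..L + \<alpha>} s * k s \<partial>lborel) - (\<integral>s. indicator {0..L} s * k s \<partial>lborel)) / L"
    using L by (simp add: integral_unif diff_divide_distrib)
  also have "\<dots> = (\<integral>s. indicator {\<alpha>..L + \<alpha>} s * k s - indicator {0..L} s * k s \<partial>lborel) / L"
    using fin by simp
  also have "\<bar>\<dots>\<bar> \<le> (\<integral>s. B * I s \<partial>lborel) / L"
  proof -
    have "\<bar>\<integral>s. indicator {\<alpha>..L + \<alpha>} s * k s - indicator {0..L} s * k s \<partial>lborel\<bar>
        \<le> (\<integral>s. \<bar>indicator {\<alpha>..L + \<alpha>} s * k s - indicator {0..L} s * k s\<bar> \<partial>lborel)"
      by (rule integral_abs_bound)
    also have "\<dots> \<le> (\<integral>s. B * I s \<partial>lborel)"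
    proof (rule integral_mono)
      fix s
      have "\<bar>indicator {\<alpha>..L + \<alpha>} s - indicat_real {0..L} s\<bar> \<le> I s"
        by (auto simp: I_def indicator_def)
      then have "\<bar>k s\<bar> * \<bar>indicator {\<alpha>..L + \<alpha>} s - indicat_real {0..L} s\<bar> \<le> B * I s"
        using B[of s] by (intro mult_mono) auto
      moreover have "indicator {\<alpha>..L + \<alpha>} s * k s - indicator {0..L} s * k s =
          k s * (indicator {\<alpha>..L + \<alpha>} s - indicat_real {0..L} s)"
        by (simp add: algebra_simps)
      ultimately show "\<bar>indicator {\<alpha>..L + \<alpha>} s * k s - indicator {0..L} s * k s\<bar> \<le> B * I s"
        by (simp only: abs_mult)
    qed (use fin I in auto)
    finally show ?thesis using L by (simp add: divide_right_mono)
  qed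
  also have "(\<integral>s. B * I s \<partial>lborel) = 4 * B * \<bar>\<alpha>\<bar>"
    unfolding I_def by (simp add: algebra_simps)
  finally show ?thesis .
qed

lemma integral_time_average:
  fixes f :: "'a::topological_space \<Rightarrow> real"
  assumes T: "T > 0" and M: "M \<in> borel \<rightarrow>\<^sub>M subprob_algebra borel"
    and f: "f \<in> borel_measurable borel" "\<And>x. \<bar>f x\<bar> \<le> B"
  shows "(\<integral>x. f x \<partial>time_average T M) = (\<integral>t. (\<integral>x. f x \<partial>M t) \<partial>unif T)"
  unfolding time_average_def
proof (rule integral_bind[where B=B and B'=1, OF f(1)])
  interpret prob_space "unif T" using T by (rule prob_space_unif)
  show "finite_measure (unif T)" by (rule finite_measure_axioms)
  show "M \<in> unif T \<rightarrow>\<^sub>M subprob_algebra borel" using M by (simp add: measurable_def)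
  have "emeasure (M t) (space (M t)) \<le> 1" for t
    using subprob_space.emeasure_space_le_1[OF subprob_space_kernel[OF M]] by simp
  then show "AE t in unif T. emeasure (M t) (space (M t)) \<le> ennreal 1" by simp
qed (use f in auto)

section \<open>The action near the identity and its measurability\<close>

locale SL2R_action =
  fixes act :: "real^2^2 \<Rightarrow> 'a::{second_countable_topology, t2_space} \<Rightarrow> 'a"
  assumes continuous_action: "continuous_SL2R_action act"
begin

lemma act_mult: "det A = 1 \<Longrightarrow> det B = 1 \<Longrightarrow> act (A ** B) x = act A (act B x)"
  using group_action.composition_rule[of SL2R UNIV act x A B] continuous_action
  by (simp add: continuous_SL2R_action_def SL2R_simps)

lemma act_one: "act (mat 1) x = x"
  using group_action.id_eq_one[of SL2R UNIV act] continuous_action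
  by (simp add: continuous_SL2R_action_def SL2R_simps) (metis restrict_UNIV)

lemma continuous_on_act:
  assumes "continuous_on S c" "\<And>p. p \<in> S \<Longrightarrow> det (c p) = 1" "continuous_on S g"
  shows "continuous_on S (\<lambda>p. act (c p) (g p))"
proof -
  have "continuous_on ({A. det A = 1} \<times> UNIV) (\<lambda>(A, x). act A x)"
    using continuous_action by (simp add: continuous_SL2R_action_def SL2R_simps)
  moreover have "continuous_on S (\<lambda>p. (c p, g p))" using assms by (intro continuous_intros)
  ultimately show ?thesis
    using continuous_on_compose2[of _ "\<lambda>(A, x). act A x" S "\<lambda>p. (c p, g p)"] assms(2) by auto
qed

sublocale horo: continuous_flow "\<lambda>s. act (horo s)"
proof
  have "continuous_on UNIV (\<lambda>p. act (horo (fst p)) (snd p))"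
    by (intro continuous_on_act continuous_on_compose2[OF continuous_on_horo] continuous_intros) auto
  then show "continuous_on UNIV (\<lambda>(s, x). act (horo s) x)" by (simp add: case_prod_unfold)
qed (simp_all add: horo_add act_mult horo_zero act_one)

text \<open>Only points with \<open>y\<close> or \<open>act (A t) y\<close> in the support
  \<open>K\<close> matter. For \<open>y\<close> in \<open>K\<close>, compactness gives uniformity.
  In the other case the same estimate is applied at \<open>act (A t) y\<close> to the inverse
  matrix, which also tends to the identity.\<close>

lemma eventually_act_close:
  assumes f: "f \<in> Cc" and A: "(A \<longlongrightarrow> mat 1) F" "\<And>t. det (A t) = 1" and \<epsilon>: "\<epsilon> > 0"
  shows "eventually (\<lambda>t. \<forall>y. \<bar>f (act (A t) y) - f y\<bar> \<le> \<epsilon>) F"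
proof -
  define K where "K = closure {x. f x \<noteq> 0}"
  have "compact K" unfolding K_def using f by (rule Cc_compact)
  have "continuous_on ({A. det A = 1} \<times> K) (\<lambda>(A, y). f (act A y))"
    unfolding case_prod_unfold
    by (intro continuous_on_compose2[OF Cc_continuous[OF f]] continuous_on_act continuous_intros) auto
  then obtain X0 where X0: "mat 1 \<in> X0" "open X0"
    "\<forall>C\<in>X0 \<inter> {A. det A = 1}. \<forall>y\<in>K. dist (f (act C y)) (f (act (mat 1) y)) \<le> \<epsilon>"
    using continuous_on_prod_compactE[OF _ \<open>compact K\<close> _ \<epsilon>, of "{A. det A = 1}" "\<lambda>(A, y). f (act A y)" "mat 1"]
    by auto
  have close: "\<bar>f (act C y) - f y\<bar> \<le> \<epsilon>" if "C \<in> X0" "det C = 1" "y \<in> K" for C y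
    using X0(3) that by (auto simp: dist_real_def act_one)
  have "eventually (\<lambda>t. A t \<in> X0) F" using A(1) X0 by (intro topological_tendstoD)
  moreover have "eventually (\<lambda>t. adj22 (A t) \<in> X0) F"
    using tendsto_adj22[OF A(1)] X0 by (intro topological_tendstoD)
  ultimately show ?thesis
  proof eventually_elim
    case (elim t)
    show ?case
    proof
      fix y
      consider "y \<in> K" | "act (A t) y \<in> K" | "y \<notin> K" "act (A t) y \<notin> K" by blast
      then show "\<bar>f (act (A t) y) - f y\<bar> \<le> \<epsilon>"
      proof cases
        case 1 then show ?thesis using close elim A(2) by blast
      next
        case 2
        have "act (adj22 (A t)) (act (A t) y) = y"
          using A(2)[of t] by (simp add: act_mult[symmetric] det_adj22 adj22_mult act_one)
        with close[of "adj22 (A t)" "act (A t) y"] 2 elim A(2)[of t] show ?thesis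
          by (simp add: det_adj22 abs_minus_commute)
      next
        case 3
        have "f y = 0" using 3(1) unfolding K_def by (rule Cc_eq_0)
        moreover have "f (act (A t) y) = 0" using 3(2) unfolding K_def by (rule Cc_eq_0)
        ultimately show ?thesis using \<epsilon> by simp
      qed
    qed
  qed
qed

lemma measurable_act_path:
  assumes "continuous_on UNIV q" "\<And>t. det (q t) = 1"
  shows "(\<lambda>(t::real, x). act (q t) x) \<in> borel_measurable (borel \<Otimes>\<^sub>M borel)"
proof -
  have "continuous_on UNIV (\<lambda>p. act (q (fst p)) (snd p))"
    using assms by (intro continuous_on_act continuous_on_compose2[OF assms(1)] continuous_intros) auto
  from borel_measurable_continuous_onI[OF this] show ?thesis by (simp add: borel_prod case_prod_unfold)
qed

lemma continuous_on_act_fixed: "det A = 1 \<Longrightarrow> continuous_on UNIV (act A)"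
  by (intro continuous_on_act continuous_intros) auto

lemma measurable_act: "det A = 1 \<Longrightarrow> act A \<in> borel \<rightarrow>\<^sub>M borel"
  by (intro borel_measurable_continuous_onI continuous_on_act_fixed)

text \<open>Measurable dependence on \<open>t\<close> is what lets the bind in
  \<open>time_average\<close> be read as an integral of measures.\<close>

lemma push_path_kernel:
  assumes q: "continuous_on UNIV q" "\<And>t. det (q t) = 1"
    and N: "prob_space N" "sets N = sets borel"
  shows "(\<lambda>t::real. push (act (q t)) N) \<in> borel \<rightarrow>\<^sub>M subprob_algebra borel"
  unfolding push_def
proof (rule measurable_distr2[where M=borel])
  show "(\<lambda>(t, x). act (q t) x) \<in> borel_measurable (borel \<Otimes>\<^sub>M borel)" using q by (rule measurable_act_path)
  show "(\<lambda>t::real. N) \<in> borel \<rightarrow>\<^sub>M subprob_algebra borel"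
    using N by (intro measurable_const) (simp add: space_subprob_algebra prob_space_imp_subprob_space)
qed

section \<open>Push-forwards along the geodesic flow and asymptotic invariance\<close>

context
  fixes \<nu> :: "'a measure"
  assumes \<nu>: "prob_space \<nu>" "sets \<nu> = sets borel"
begin

abbreviation geo_push :: "real \<Rightarrow> 'a measure" where
  "geo_push t \<equiv> push (act (geo t)) \<nu>"

lemma geo_push_prob: "prob_space (geo_push t)" "sets (geo_push t) = sets borel"
  unfolding push_def using \<nu> measurable_act[of "geo t"]
  by (auto intro!: prob_space.prob_space_distr cong: measurable_cong_sets)

lemma integral_geo_push:
  fixes f :: "'a \<Rightarrow> real"
  assumes "f \<in> borel_measurable borel"
  shows "(\<integral>x. f x \<partial>geo_push t) = (\<integral>x. f (act (geo t) x) \<partial>\<nu>)"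
  unfolding push_def using assms measurable_act[of "geo t"] \<nu>
  by (intro integral_distr) (auto cong: measurable_cong_sets)

lemma geo_push_kernel: "geo_push \<in> borel \<rightarrow>\<^sub>M subprob_algebra borel"
  by (rule push_path_kernel[OF continuous_on_geo _ \<nu>]) simp

lemma measurable_integral_geo_push:
  assumes "(f :: 'a \<Rightarrow> real) \<in> borel_measurable borel"
  shows "(\<lambda>t. \<integral>x. f x \<partial>geo_push t) \<in> borel_measurable borel"
  using measurable_compose[OF geo_push_kernel integral_measurable_subprob_algebra[OF assms]] .

lemma integrable_geo_push:
  assumes "f \<in> Cc"
  shows "integrable (geo_push t) f"
proof -
  obtain B where "\<And>x. \<bar>f x\<bar> \<le> B" using Cc_bounded[OF assms] by blast
  then show ?thesis using Cc_measurable[OF assms] geo_push_prob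
    by (intro integrable_prob_bounded[where B=B]) (auto cong: measurable_cong_sets)
qed

lemma abs_integral_geo_push_le:
  assumes "f \<in> Cc" "\<And>x. \<bar>f x\<bar> \<le> B"
  shows "\<bar>\<integral>x. f x \<partial>geo_push t\<bar> \<le> B"
proof -
  interpret prob_space "geo_push t" by (rule geo_push_prob)
  have "\<bar>\<integral>x. f x \<partial>geo_push t\<bar> \<le> (\<integral>x. \<bar>f x\<bar> \<partial>geo_push t)" by (rule integral_abs_bound)
  also have "\<dots> \<le> B"
    using assms integrable_geo_push[OF assms(1), of t] by (intro integral_le_const integrable_abs) auto
  finally show ?thesis .
qed

text \<open>What the three types of \<nu> have in common. The limit is taken for each fixed
  \<open>r\<close>, which suits the members of \<open>midhull\<close>, as they arise from finitely
  many translations.\<close>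

definition asymptotically_invariant :: bool where
  "asymptotically_invariant \<longleftrightarrow> (\<forall>f\<in>Cc. \<forall>r.
     ((\<lambda>t. (\<integral>x. f (act (horo r) x) \<partial>geo_push t) - (\<integral>x. f x \<partial>geo_push t)) \<longlongrightarrow> 0) at_top)"

text \<open>By \<open>horo_mult_geo\<close> the translation moves past \<open>geo t\<close> and is
  absorbed by \<nu>, so the difference vanishes for every \<open>t\<close>.\<close>

lemma asymptotically_invariant_horo_invariant:
  assumes inv: "\<And>s. push (act (horo s)) \<nu> = \<nu>"
  shows asymptotically_invariant
  unfolding asymptotically_invariant_def
proof (intro ballI allI)
  fix f :: "'a \<Rightarrow> real" and r assume f: "f \<in> Cc"
  have "(\<integral>x. f (act (horo r) x) \<partial>geo_push t) = (\<integral>x. f x \<partial>geo_push t)" for t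
  proof -
    have fm: "f \<in> borel_measurable borel" using f by (rule Cc_measurable)
    have fh: "(\<lambda>x. f (act (horo r) x)) \<in> borel_measurable borel"
      using measurable_compose[OF measurable_act fm] by simp
    have fg: "(\<lambda>x. f (act (geo t) x)) \<in> borel_measurable borel"
      using measurable_compose[OF measurable_act fm] by simp
    let ?s = "r * exp (- 2 * t)"
    have "(\<integral>x. f (act (horo r) x) \<partial>geo_push t) = (\<integral>x. f (act (geo t) (act (horo ?s) x)) \<partial>\<nu>)"
      using fh by (simp add: integral_geo_push act_mult[symmetric] horo_mult_geo)
    also have "\<dots> = (\<integral>x. f (act (geo t) x) \<partial>push (act (horo ?s)) \<nu>)"
      unfolding push_def using fg measurable_act[of "horo ?s"] \<nu>
      by (intro integral_distr[symmetric]) (auto cong: measurable_cong_sets)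
    also have "\<dots> = (\<integral>x. f x \<partial>geo_push t)" using fm inv by (simp add: integral_geo_push)
    finally show ?thesis .
  qed
  then show "((\<lambda>t. (\<integral>x. f (act (horo r) x) \<partial>geo_push t) - (\<integral>x. f x \<partial>geo_push t)) \<longlongrightarrow> 0) at_top" by simp
qed

text \<open>Moving the starting point along \<open>q\<close> by \<open>\<alpha> t\<close> has, after time \<open>t\<close>, the effect of \<open>horo r\<close>
  up to a correction tending to the identity, while it changes the average over \<open>[0, L]\<close> by
  \<open>O(\<alpha> t)\<close>.\<close>

lemma asymptotically_invariant_path:
  assumes L: "L > 0" and \<nu>_eq: "\<nu> = time_average L (\<lambda>s. push (act (q s)) (dirac x))"
    and q: "continuous_on UNIV q" "\<And>s. det (q s) = 1" "\<And>s u. q (s + u) = q s ** q u"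
    and \<alpha>: "\<And>r. (\<alpha> r \<longlongrightarrow> 0) at_top"
    and A: "\<And>r. ((\<lambda>t. geo t ** q (\<alpha> r t) ** geo (- t) ** horo (- r)) \<longlongrightarrow> mat 1) at_top"
  shows asymptotically_invariant
  unfolding asymptotically_invariant_def
proof (intro ballI allI)
  fix f :: "'a \<Rightarrow> real" and r assume f: "f \<in> Cc"
  obtain B where B0: "B \<ge> 0" and B: "\<And>x. \<bar>f x\<bar> \<le> B" using Cc_bounded[OF f] by blast
  have fm: "f \<in> borel_measurable borel" using f by (rule Cc_measurable)
  have avg: "(\<integral>y. g y \<partial>geo_push t) = (\<integral>s. g (act (geo t) (act (q s) x)) \<partial>unif L)"
    if g: "g \<in> Cc" for g t
  proof -
    obtain C where C: "\<And>x. \<bar>g x\<bar> \<le> C" using Cc_bounded[OF g] by blast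
    have gm: "g \<in> borel_measurable borel" using g by (rule Cc_measurable)
    have gg: "(\<lambda>x. g (act (geo t) x)) \<in> borel_measurable borel"
      using measurable_compose[OF measurable_act gm] by simp
    have K: "(\<lambda>s. push (act (q s)) (dirac x)) \<in> borel \<rightarrow>\<^sub>M subprob_algebra borel"
      using q by (intro push_path_kernel) (auto simp: dirac_def prob_space_return)
    have pt: "(\<integral>y. g (act (geo t) y) \<partial>push (act (q s)) (dirac x)) = g (act (geo t) (act (q s) x))" for s
      unfolding push_def dirac_def using gg measurable_act[OF q(2), of s]
      by (subst distr_return) (auto simp: integral_return)
    have "(\<integral>y. g y \<partial>geo_push t) = (\<integral>y. g (act (geo t) y) \<partial>time_average L (\<lambda>s. push (act (q s)) (dirac x)))"
      unfolding \<nu>_eq[symmetric] using gm by (rule integral_geo_push)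
    also have "\<dots> = (\<integral>s. (\<integral>y. g (act (geo t) y) \<partial>push (act (q s)) (dirac x)) \<partial>unif L)"
      by (rule integral_time_average[OF L K gg C])
    also have "\<dots> = (\<integral>s. g (act (geo t) (act (q s) x)) \<partial>unif L)" by (simp only: pt)
    finally show ?thesis .
  qed
  \<comment> \<open>Solved from the demand that \<open>A t\<close> carry the \<open>horo r\<close>
    translate of the point at parameter \<open>s\<close> to the point at parameter
    \<open>s + \<alpha> r t\<close>. It does not depend on \<open>s\<close>, because
    \<open>q\<close> is a homomorphism.\<close>
  define A where "A t = geo t ** q (\<alpha> r t) ** geo (- t) ** horo (- r)" for t
  have detA: "det (A t) = 1" for t by (simp add: A_def det_mul q(2))
  have A_eq: "A t ** horo r ** geo t ** q s = geo t ** q (s + \<alpha> r t)" for t s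
  proof -
    have "horo (- r) ** horo r = mat 1" using horo_add[of "-r" r] by (simp add: horo_zero)
    then have "A t ** horo r = geo t ** q (\<alpha> r t) ** geo (- t)"
      unfolding A_def by (simp add: matrix_mul_assoc[symmetric])
    then have "A t ** horo r ** geo t = geo t ** q (\<alpha> r t)"
      by (simp add: matrix_mul_assoc[symmetric] geo_mult_geo_uminus)
    then show ?thesis by (simp add: add.commute[of s] q(3) matrix_mul_assoc)
  qed
  show "((\<lambda>t. (\<integral>x. f (act (horo r) x) \<partial>geo_push t) - (\<integral>x. f x \<partial>geo_push t)) \<longlongrightarrow> 0) at_top"
  proof (rule tendstoI)
    fix \<epsilon> :: real assume \<epsilon>: "\<epsilon> > 0"
    have "eventually (\<lambda>t. \<forall>y. \<bar>f (act (A t) y) - f y\<bar> \<le> \<epsilon> / 2) at_top"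
      using A[of r] detA \<epsilon> f by (intro eventually_act_close) (auto simp: A_def)
    moreover have "((\<lambda>t. 4 * B * \<bar>\<alpha> r t\<bar> / L) \<longlongrightarrow> 4 * B * \<bar>0\<bar> / L) at_top"
      using L by (intro tendsto_intros \<alpha>) auto
    then have "eventually (\<lambda>t. 4 * B * \<bar>\<alpha> r t\<bar> / L < \<epsilon> / 2) at_top"
      using \<epsilon> by (intro order_tendstoD) auto
    ultimately show "eventually (\<lambda>t. dist ((\<integral>x. f (act (horo r) x) \<partial>geo_push t) - (\<integral>x. f x \<partial>geo_push t)) 0 < \<epsilon>) at_top"
    proof eventually_elim
      case (elim t)
      interpret prob_space "unif L" using L by (rule prob_space_unif)
      define k where "k s = f (act (geo t) (act (q s) x))" for s
      define l where "l s = f (act (horo r) (act (geo t) (act (q s) x)))" for s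
      have "continuous_on UNIV k" "continuous_on UNIV l" unfolding k_def l_def
        using q by (auto intro!: continuous_on_compose2[OF Cc_continuous[OF f]] continuous_on_act 
            continuous_on_compose2[OF q(1)] continuous_intros)
      then have km [measurable]: "k \<in> borel_measurable borel" "l \<in> borel_measurable borel"
        by (auto intro: borel_measurable_continuous_onI)
      have kB: "\<bar>k s\<bar> \<le> B" "\<bar>l s\<bar> \<le> B" for s unfolding k_def l_def by (rule B)+
      \<comment> \<open>The estimate for \<open>A t\<close> is uniform over the space, hence uniform
        in \<open>s\<close>, and so survives averaging over the arc.\<close>
      have lk: "\<bar>l s - k (s + \<alpha> r t)\<bar> \<le> \<epsilon> / 2" for s
      proof -
        have "act (geo t) (act (q (s + \<alpha> r t)) x) = act (A t) (act (horo r) (act (geo t) (act (q s) x)))"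
          using detA by (simp add: act_mult[symmetric] A_eq[symmetric] q(2) det_mul matrix_mul_assoc)
        then have "k (s + \<alpha> r t) = f (act (A t) (act (horo r) (act (geo t) (act (q s) x))))"
          by (simp add: k_def)
        then show ?thesis
          using elim(1)[rule_format, of "act (horo r) (act (geo t) (act (q s) x))"]
          by (simp add: l_def abs_minus_commute)
      qed
      have il: "integrable (unif L) l" "integrable (unif L) (\<lambda>s. k (s + \<alpha> r t))"
        using kB by (auto intro!: integrable_prob_bounded[OF prob_space_axioms, where B=B])
      have "\<bar>(\<integral>s. l s \<partial>unif L) - (\<integral>s. k (s + \<alpha> r t) \<partial>unif L)\<bar> \<le> \<epsilon> / 2"
      proof -
        have "(\<integral>s. l s \<partial>unif L) - (\<integral>s. k (s + \<alpha> r t) \<partial>unif L) = (\<integral>s. l s - k (s + \<alpha> r t) \<partial>unif L)"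
          using il by simp
        also have "\<bar>\<dots>\<bar> \<le> (\<integral>s. \<bar>l s - k (s + \<alpha> r t)\<bar> \<partial>unif L)" by (rule integral_abs_bound)
        also have "\<dots> \<le> \<epsilon> / 2" using il lk by (intro integral_le_const integrable_abs) auto
        finally show ?thesis .
      qed
      moreover have "\<bar>(\<integral>s. k (s + \<alpha> r t) \<partial>unif L) - (\<integral>s. k s \<partial>unif L)\<bar> \<le> 4 * B * \<bar>\<alpha> r t\<bar> / L"
        using L km(1) kB(1) by (rule integral_unif_shift_le)
      moreover have "(\<integral>x. f (act (horo r) x) \<partial>geo_push t) = (\<integral>s. l s \<partial>unif L)"
        unfolding l_def by (rule avg[OF horo.Cc_flow[OF f]])
      moreover have "(\<integral>x. f x \<partial>geo_push t) = (\<integral>s. k s \<partial>unif L)"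
        unfolding k_def by (rule avg[OF f])
      ultimately have "\<bar>(\<integral>x. f (act (horo r) x) \<partial>geo_push t) - (\<integral>x. f x \<partial>geo_push t)\<bar> < \<epsilon>"
        using elim(2) by linarith
      then show ?case by (simp add: dist_real_def)
    qed
  qed
qed

text \<open>Conjugation by \<open>geo t\<close> turns \<open>horo (r * exp (- 2 * t))\<close> into
  exactly \<open>horo r\<close>, so the correction is the identity.\<close>

lemma asymptotically_invariant_horo_arc:
  assumes "S > 0" "\<nu> = time_average S (\<lambda>s. push (act (horo s)) (dirac x))"
  shows asymptotically_invariant
proof (rule asymptotically_invariant_path[OF assms continuous_on_horo])
  show "((\<lambda>t. r * exp (- 2 * t)) \<longlongrightarrow> 0) at_top" for r :: real
    by (intro tendsto_mult_right_zero filterlim_compose[OF exp_at_bot]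
        filterlim_tendsto_neg_mult_at_bot[OF tendsto_const] filterlim_ident) simp
  have "geo t ** horo (r * exp (- 2 * t)) ** geo (- t) ** horo (- r) = mat 1" for r t
  proof -
    have "geo t ** horo (r * exp (- 2 * t)) ** geo (- t) = horo r ** (geo t ** geo (- t))"
      unfolding horo_mult_geo[symmetric] by (rule matrix_mul_assoc[symmetric])
    then have "geo t ** horo (r * exp (- 2 * t)) ** geo (- t) = horo r"
      by (simp only: geo_mult_geo_uminus matrix_mul_rid)
    then show ?thesis using horo_add[of r "-r"] by (simp add: horo_zero)
  qed
  then show "((\<lambda>t. geo t ** horo (r * exp (- 2 * t)) ** geo (- t) ** horo (- r)) \<longlongrightarrow> mat 1) at_top" for r
    by simp
qed (simp_all add: horo_add)

text \<open>The angle has tangent \<open>r * exp (- 2 * t)\<close>. Conjugation by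
  \<open>geo t\<close> then makes the upper right entry \<open>r\<close> times the upper left one,
  so multiplying by \<open>horo (- r)\<close> leaves a lower triangular matrix, which tends to the
  identity.\<close>

lemma asymptotically_invariant_rot_arc:
  assumes "\<Theta> > 0" "\<nu> = time_average \<Theta> (\<lambda>\<theta>. push (act (rot \<theta>)) (dirac x))"
  shows asymptotically_invariant
proof (rule asymptotically_invariant_path[OF assms continuous_on_rot])
  define \<tau> where "\<tau> = (\<lambda>r t :: real. r * exp (- 2 * t))"
  have \<tau>: "(\<tau> r \<longlongrightarrow> 0) at_top" for r unfolding \<tau>_def
    by (intro tendsto_mult_right_zero filterlim_compose[OF exp_at_bot]
        filterlim_tendsto_neg_mult_at_bot[OF tendsto_const] filterlim_ident) simp
  show \<alpha>: "((\<lambda>t. arctan (\<tau> r t)) \<longlongrightarrow> 0) at_top" for r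
    using tendsto_arctan[OF \<tau>[of r]] by simp
  show "((\<lambda>t. geo t ** rot (arctan (\<tau> r t)) ** geo (- t) ** horo (- r)) \<longlongrightarrow> mat 1) at_top" for r
  proof -
    define c where "c t = cos (arctan (\<tau> r t))" for t
    have c: "(c \<longlongrightarrow> 1) at_top" unfolding c_def using tendsto_cos[OF \<alpha>[of r]] by simp
    have s: "sin (arctan (\<tau> r t)) = \<tau> r t * c t" for t
      by (simp add: c_def sin_arctan cos_arctan)
    have e: "exp t * (exp t * exp (- (2 * t))) = 1" for t :: real
      by (simp flip: exp_add)
    have eq: "geo t ** rot (arctan (\<tau> r t)) ** geo (- t) ** horo (- r) =
        mat22 (c t) 0 (- (exp (- 2 * t) * \<tau> r t * c t)) (c t + r * exp (- 2 * t) * \<tau> r t * c t)" for t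
      unfolding geo_def rot_def horo_def mat22_mult s c_def[symmetric]
      using e[of t] by (simp add: mat22_eq_iff \<tau>_def algebra_simps flip: exp_add)
    have ex: "((\<lambda>t::real. exp (- 2 * t)) \<longlongrightarrow> 0) at_top" using \<tau>[of 1] by (simp add: \<tau>_def)
    have "((\<lambda>t. - (exp (- 2 * t) * \<tau> r t * c t)) \<longlongrightarrow> - (0 * 0 * 1)) at_top"
      by (intro tendsto_intros ex \<tau> c)
    moreover have "((\<lambda>t. c t + r * exp (- 2 * t) * \<tau> r t * c t) \<longlongrightarrow> 1 + r * 0 * 0 * 1) at_top"
      by (intro tendsto_intros ex \<tau> c)
    ultimately show ?thesis unfolding eq
      using c by (intro tendsto_mat22) (simp_all add: mat_def)
  qed
qed (simp_all add: rot_add)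

section \<open>From asymptotic invariance to convergence outside a set of zero density\<close>

context
  fixes \<mu> :: "'a measure"
  assumes asymptotic: asymptotically_invariant
    and average: "weak_star_tendsto (\<lambda>T. time_average T geo_push) \<mu> at_top"
    and ergodic: "flow_ergodic (\<lambda>s. act (horo s)) \<mu>"
begin

lemma asymptotic_midhull:
  assumes "F \<in> horo.midhull f" "f \<in> Cc"
  shows "((\<lambda>t. (\<integral>x. F x \<partial>geo_push t) - (\<integral>x. f x \<partial>geo_push t)) \<longlongrightarrow> 0) at_top"
  using assms(1)
proof (induction rule: horo.midhull.induct)
  case (shift F s)
  have "F \<in> Cc" using shift.hyps assms(2) by (rule horo.midhull_Cc)
  then have "((\<lambda>t. (\<integral>x. F (act (horo s) x) \<partial>geo_push t) - (\<integral>x. F x \<partial>geo_push t)) \<longlongrightarrow> 0) at_top"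
    using asymptotic by (simp add: asymptotically_invariant_def)
  from tendsto_add[OF this shift.IH] show ?case by simp
next
  case (mid F G)
  have "integrable (geo_push t) F" "integrable (geo_push t) G" for t
    using mid.hyps assms(2) by (auto intro!: integrable_geo_push intro: horo.midhull_Cc)
  then have eq: "(\<integral>x. (F x + G x) / 2 \<partial>geo_push t) - (\<integral>x. f x \<partial>geo_push t) =
    (((\<integral>x. F x \<partial>geo_push t) - (\<integral>x. f x \<partial>geo_push t)) + ((\<integral>x. G x \<partial>geo_push t) - (\<integral>x. f x \<partial>geo_push t))) / 2" for t
    by (simp add: field_simps)
  have "((\<lambda>t. (((\<integral>x. F x \<partial>geo_push t) - (\<integral>x. f x \<partial>geo_push t)) +
      ((\<integral>x. G x \<partial>geo_push t) - (\<integral>x. f x \<partial>geo_push t))) / 2) \<longlongrightarrow> (0 + 0) / 2) at_top"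
    by (intro tendsto_intros mid.IH) simp
  then show ?case unfolding eq by simp
qed simp

lemma average_integral_tendsto:
  assumes "f \<in> Cc"
  shows "((\<lambda>T. \<integral>t. (\<integral>x. f x \<partial>geo_push t) \<partial>unif T) \<longlongrightarrow> (\<integral>x. f x \<partial>\<mu>)) at_top"
proof (rule Lim_transform_eventually)
  show "((\<lambda>T. \<integral>x. f x \<partial>time_average T geo_push) \<longlongrightarrow> (\<integral>x. f x \<partial>\<mu>)) at_top"
    using average assms by (simp add: weak_star_tendsto_def Cc_def)
  obtain B where "\<And>x. \<bar>f x\<bar> \<le> B" using Cc_bounded[OF assms] by blast
  then show "eventually (\<lambda>T. (\<integral>x. f x \<partial>time_average T geo_push) = (\<integral>t. (\<integral>x. f x \<partial>geo_push t) \<partial>unif T)) at_top"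
    using integral_time_average[OF _ geo_push_kernel Cc_measurable[OF assms]]
    by (auto intro: eventually_mono[OF eventually_gt_at_top[of 0]])
qed

lemma mean_square_tendsto:
  assumes f: "f \<in> Cc"
  shows "((\<lambda>T. \<integral>t. ((\<integral>x. f x \<partial>geo_push t) - (\<integral>x. f x \<partial>\<mu>))\<^sup>2 \<partial>unif T) \<longlongrightarrow> 0) at_top"
proof (rule tendstoI)
  fix \<epsilon> :: real assume \<epsilon>: "\<epsilon> > 0"
  define c where "c = (\<integral>x. f x \<partial>\<mu>)"
  \<comment> \<open>The bound \<open>\<epsilon> / 4\<close> anticipates \<open>ineq\<close>, where
    two terms of this size each carry a factor \<open>2\<close>.\<close>
  obtain F where FH: "F \<in> horo.midhull f" and F\<epsilon>: "(\<integral>x. (F x - c)\<^sup>2 \<partial>\<mu>) < \<epsilon> / 4"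
    using horo.midhull_approximates_mean[OF ergodic f, of "\<epsilon>/4"] \<epsilon> unfolding c_def by auto
  have F: "F \<in> Cc" using FH f by (rule horo.midhull_Cc)
  have F2: "(\<lambda>x. (F x)\<^sup>2) \<in> Cc" using F by (rule Cc_square)
  obtain B where B: "\<And>x. \<bar>f x\<bar> \<le> B" using Cc_bounded[OF f] by blast
  have BF: "\<bar>F x\<bar> \<le> B" for x using FH B by (rule horo.midhull_bounded)
  have BF2: "\<bar>(F x)\<^sup>2\<bar> \<le> B\<^sup>2" for x using power_mono[OF BF[of x], of 2] by simp
  \<comment> \<open>\<open>(F - c)^2\<close> need not have compact support. Expanding leaves the
    test functions \<open>F^2\<close> and \<open>F\<close> and a constant, which every probability
    measure integrates to \<open>c^2\<close>.\<close>
  have expand: "(\<integral>x. (F x - c)\<^sup>2 \<partial>N) = (\<integral>x. (F x)\<^sup>2 \<partial>N) - 2 * c * (\<integral>x. F x \<partial>N) + c\<^sup>2"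
    if "prob_space N" "sets N = sets borel" for N
  proof -
    interpret prob_space N by fact
    have "integrable N F"
      using BF Cc_measurable[OF F] that(2)
      by (intro integrable_prob_bounded[OF that(1), where B=B]) (auto cong: measurable_cong_sets)
    moreover have "integrable N (\<lambda>x. (F x)\<^sup>2)"
      using BF2 Cc_measurable[OF F2] that(2)
      by (intro integrable_prob_bounded[OF that(1), where B="B\<^sup>2"]) (auto cong: measurable_cong_sets)
    ultimately show ?thesis using prob_space by (simp add: power2_diff mult_ac)
  qed
  define a where "a t = (\<integral>x. f x \<partial>geo_push t)" for t
  define b where "b t = (\<integral>x. F x \<partial>geo_push t)" for t
  define p where "p t = (\<integral>x. (F x)\<^sup>2 \<partial>geo_push t) - 2 * c * b t + c\<^sup>2" for t
  have [measurable]: "a \<in> borel_measurable borel" "b \<in> borel_measurable borel" "p \<in> borel_measurable borel"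
    unfolding a_def b_def p_def using Cc_measurable[OF f] Cc_measurable[OF F] Cc_measurable[OF F2]
    by (auto intro!: measurable_integral_geo_push borel_measurable_add borel_measurable_diff borel_measurable_times)
  have ab: "\<bar>a t\<bar> \<le> B" "\<bar>b t\<bar> \<le> B" "\<bar>\<integral>x. (F x)\<^sup>2 \<partial>geo_push t\<bar> \<le> B\<^sup>2" for t
    unfolding a_def b_def using abs_integral_geo_push_le[OF f B] abs_integral_geo_push_le[OF F BF]
      abs_integral_geo_push_le[OF F2 BF2] by auto
  have bp: "(b t - c)\<^sup>2 \<le> p t" for t
  proof -
    interpret prob_space "geo_push t" by (rule geo_push_prob)
    have m: "F \<in> borel_measurable (geo_push t)" 
      using Cc_measurable[OF F] geo_push_prob(2)[of t] by (simp cong: measurable_cong_sets)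
    have "(\<integral>x. F x - c \<partial>geo_push t)\<^sup>2 \<le> (\<integral>x. (F x - c)\<^sup>2 \<partial>geo_push t)"
    proof (rule square_expectation_le)
      show "\<bar>F x - c\<bar> \<le> B + \<bar>c\<bar>" for x using BF[of x] by linarith
    qed (use m in measurable)
    then show ?thesis
      using expand[OF geo_push_prob] integrable_geo_push[OF F, of t] prob_space by (simp add: p_def b_def)
  qed
  have ineq: "(a t - c)\<^sup>2 \<le> 2 * p t + 2 * (b t - a t)\<^sup>2" for t
  proof -
    \<comment> \<open>The parallelogram law for \<open>b t - c\<close> and \<open>b t - a t\<close>,
      whose difference is \<open>a t - c\<close>.\<close>
    have "(a t - c)\<^sup>2 = 2 * (b t - c)\<^sup>2 + 2 * (b t - a t)\<^sup>2 - (2 * b t - a t - c)\<^sup>2"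
      by (simp add: power2_eq_square algebra_simps)
    then show ?thesis using bp[of t] by (smt (verit) zero_le_power2)
  qed
  have "((\<lambda>t. b t - a t) \<longlongrightarrow> 0) at_top" unfolding a_def b_def using FH f by (rule asymptotic_midhull)
  then have "((\<lambda>t. (b t - a t)\<^sup>2) \<longlongrightarrow> 0\<^sup>2) at_top" by (intro tendsto_intros)
  moreover have ba: "\<bar>(b t - a t)\<^sup>2\<bar> \<le> (2 * B)\<^sup>2" for t
  proof -
    have "\<bar>b t - a t\<bar> \<le> 2 * B" using ab[of t] by linarith
    from power_mono[OF this, of 2] show ?thesis by simp
  qed
  ultimately have w: "((\<lambda>T. \<integral>t. (b t - a t)\<^sup>2 \<partial>unif T) \<longlongrightarrow> 0) at_top"
    by (intro tendsto_unif_integral_0) auto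
  have pc: "(\<integral>t. p t \<partial>unif T) = (\<integral>t. (\<integral>x. (F x)\<^sup>2 \<partial>geo_push t) \<partial>unif T) - 2 * c * (\<integral>t. b t \<partial>unif T) + c\<^sup>2"
    and ip: "integrable (unif T) p" if T: "T > 0" for T
  proof -
    interpret prob_space "unif T" using T by (rule prob_space_unif)
    have i: "integrable (unif T) b"
      using ab by (intro integrable_prob_bounded[OF prob_space_axioms, where B=B]) auto
    have i2: "integrable (unif T) (\<lambda>t. \<integral>x. (F x)\<^sup>2 \<partial>geo_push t)"
      using ab measurable_integral_geo_push[OF Cc_measurable[OF F2]]
      by (intro integrable_prob_bounded[OF prob_space_axioms, where B="B\<^sup>2"]) auto
    from i i2 show "(\<integral>t. p t \<partial>unif T) = (\<integral>t. (\<integral>x. (F x)\<^sup>2 \<partial>geo_push t) \<partial>unif T) - 2 * c * (\<integral>t. b t \<partial>unif T) + c\<^sup>2"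
      unfolding p_def using prob_space by simp
    show "integrable (unif T) p" unfolding p_def using i i2 by auto
  qed
  have "((\<lambda>T. \<integral>t. p t \<partial>unif T) \<longlongrightarrow> (\<integral>x. (F x)\<^sup>2 \<partial>\<mu>) - 2 * c * (\<integral>x. F x \<partial>\<mu>) + c\<^sup>2) at_top"
  proof (rule Lim_transform_eventually)
    show "((\<lambda>T. (\<integral>t. (\<integral>x. (F x)\<^sup>2 \<partial>geo_push t) \<partial>unif T) - 2 * c * (\<integral>t. b t \<partial>unif T) + c\<^sup>2)
        \<longlongrightarrow> (\<integral>x. (F x)\<^sup>2 \<partial>\<mu>) - 2 * c * (\<integral>x. F x \<partial>\<mu>) + c\<^sup>2) at_top"
      unfolding b_def by (intro tendsto_intros average_integral_tendsto F F2)
    show "eventually (\<lambda>T. (\<integral>t. (\<integral>x. (F x)\<^sup>2 \<partial>geo_push t) \<partial>unif T) - 2 * c * (\<integral>t. b t \<partial>unif T) + c\<^sup>2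
        = (\<integral>t. p t \<partial>unif T)) at_top"
      using pc by (auto intro: eventually_mono[OF eventually_gt_at_top[of 0]])
  qed
  then have "((\<lambda>T. \<integral>t. p t \<partial>unif T) \<longlongrightarrow> (\<integral>x. (F x - c)\<^sup>2 \<partial>\<mu>)) at_top"
    using expand[OF horo.ergodic_prob_space[OF ergodic] horo.sets_ergodic[OF ergodic]] by simp
  then have "eventually (\<lambda>T. (\<integral>t. p t \<partial>unif T) < \<epsilon> / 4) at_top"
    using F\<epsilon> by (rule order_tendstoD)
  moreover have "eventually (\<lambda>T. (\<integral>t. (b t - a t)\<^sup>2 \<partial>unif T) < \<epsilon> / 4) at_top"
    using w \<epsilon> by (intro order_tendstoD(2)[OF w]) auto
  ultimately show "eventually (\<lambda>T. dist (\<integral>t. ((\<integral>x. f x \<partial>geo_push t) - (\<integral>x. f x \<partial>\<mu>))\<^sup>2 \<partial>unif T) 0 < \<epsilon>) at_top"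
    using eventually_gt_at_top[of 0]
  proof eventually_elim
    case (elim T)
    interpret prob_space "unif T" using elim(3) by (rule prob_space_unif)
    have ib: "integrable (unif T) (\<lambda>t. (b t - a t)\<^sup>2)"
      using ba by (intro integrable_prob_bounded[OF prob_space_axioms]) auto
    have ia: "integrable (unif T) (\<lambda>t. (a t - c)\<^sup>2)"
    proof (rule integrable_prob_bounded[OF prob_space_axioms, where B="(B + \<bar>c\<bar>)\<^sup>2"])
      fix t
      have "\<bar>a t - c\<bar> \<le> B + \<bar>c\<bar>" using ab(1)[of t] by linarith
      from power_mono[OF this, of 2] show "\<bar>(a t - c)\<^sup>2\<bar> \<le> (B + \<bar>c\<bar>)\<^sup>2" by simp
    qed measurable
    have "(\<integral>t. (a t - c)\<^sup>2 \<partial>unif T) \<le> (\<integral>t. 2 * p t + 2 * (b t - a t)\<^sup>2 \<partial>unif T)"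
      using ia ib ip[OF elim(3)] ineq by (intro integral_mono) auto
    also have "\<dots> = 2 * (\<integral>t. p t \<partial>unif T) + 2 * (\<integral>t. (b t - a t)\<^sup>2 \<partial>unif T)"
      using ib ip[OF elim(3)] by simp
    also have "\<dots> < \<epsilon>" using elim by linarith
    finally have "(\<integral>t. (a t - c)\<^sup>2 \<partial>unif T) < \<epsilon>" .
    then show ?case unfolding a_def c_def by (simp add: dist_real_def)
  qed
qed

lemma tendsto_outside_zero_density:
  assumes lc: "locally_compact_space (euclidean :: 'a topology)"
  shows "\<exists>Z. zero_upper_density Z \<and> weak_star_tendsto geo_push \<mu> (inf at_top (principal (- Z)))"
proof -
  obtain D :: "nat \<Rightarrow> 'a \<Rightarrow> real" where D: "\<And>n. D n \<in> Cc"
    "\<And>f. continuous_on UNIV f \<Longrightarrow> (\<And>x. 0 \<le> f x) \<Longrightarrow>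
      \<exists>r. \<forall>x. (\<forall>k. 0 \<le> D (r k) x \<and> D (r k) x \<le> f x) \<and> (\<lambda>k. D (r k) x) \<longlonglongrightarrow> f x"
    using countable_approximation_from_below[OF lc] by blast
  define u where "u n t = (\<integral>x. D n x \<partial>geo_push t) - (\<integral>x. D n x \<partial>\<mu>)" for n t
  \<comment> \<open>Truncation brings the squares into \<open>[0, 1]\<close>, the range required for
    the exceptional set, without affecting convergence to \<open>0\<close>.\<close>
  define v where "v n t = min 1 ((u n t)\<^sup>2)" for n t
  have um [measurable]: "u n \<in> borel_measurable borel" for n
    unfolding u_def using measurable_integral_geo_push[OF Cc_measurable[OF D(1)]] by auto
  have vm [measurable]: "v n \<in> borel_measurable borel" for n unfolding v_def by measurable
  have v01: "0 \<le> v n t" "v n t \<le> 1" for n t by (auto simp: v_def)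
  have "((\<lambda>T. \<integral>t. v n t \<partial>unif T) \<longlongrightarrow> 0) at_top" for n
  proof (rule tendsto_sandwich[OF _ _ tendsto_const mean_square_tendsto[OF D(1)[of n]]])
    show "eventually (\<lambda>T. (\<integral>t. v n t \<partial>unif T) \<le> (\<integral>t. ((\<integral>x. D n x \<partial>geo_push t) - (\<integral>x. D n x \<partial>\<mu>))\<^sup>2 \<partial>unif T)) at_top"
      using eventually_gt_at_top[of 0]
    proof eventually_elim
      case (elim T)
      interpret prob_space "unif T" using elim by (rule prob_space_unif)
      obtain B where B: "\<And>x. \<bar>D n x\<bar> \<le> B" using Cc_bounded[OF D(1)[of n]] by blast
      have "integrable (unif T) (\<lambda>t. (u n t)\<^sup>2)"
      proof (rule integrable_prob_bounded[OF prob_space_axioms])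
        fix t
        have "\<bar>u n t\<bar> \<le> B + \<bar>\<integral>x. D n x \<partial>\<mu>\<bar>"
          using abs_integral_geo_push_le[OF D(1) B, of t] unfolding u_def by linarith
        from power_mono[OF this, of 2] show "\<bar>(u n t)\<^sup>2\<bar> \<le> (B + \<bar>\<integral>x. D n x \<partial>\<mu>\<bar>)\<^sup>2" by simp
      qed measurable
      moreover have "integrable (unif T) (v n)"
        using v01 by (intro integrable_prob_bounded[OF prob_space_axioms, where B=1]) auto
      ultimately have "(\<integral>t. v n t \<partial>unif T) \<le> (\<integral>t. (u n t)\<^sup>2 \<partial>unif T)"
        by (intro integral_mono) (auto simp: v_def)
      then show ?case by (simp add: u_def)
    qed
  qed (simp add: v01)
  from zero_upper_density_exceptional_set_countable[of v, OF vm v01 this]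
  obtain Z where Z: "zero_upper_density Z" "\<And>n. (v n \<longlongrightarrow> 0) (inf at_top (principal (- Z)))" by blast
  have lim: "((\<lambda>t. \<integral>x. D n x \<partial>geo_push t) \<longlongrightarrow> (\<integral>x. D n x \<partial>\<mu>)) (inf at_top (principal (- Z)))" for n
  proof (rule tendstoI)
    fix \<epsilon> :: real assume \<epsilon>: "\<epsilon> > 0"
    \<comment> \<open>Values below \<open>1\<close> are unaffected by the truncation; hence the
      minimum with \<open>1\<close>.\<close>
    then have "eventually (\<lambda>t. v n t < min 1 (\<epsilon>\<^sup>2)) (inf at_top (principal (- Z)))"
      using Z(2)[of n] by (intro order_tendstoD) auto
    then show "eventually (\<lambda>t. dist (\<integral>x. D n x \<partial>geo_push t) (\<integral>x. D n x \<partial>\<mu>) < \<epsilon>) (inf at_top (principal (- Z)))"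
    proof eventually_elim
      case (elim t)
      then have "\<bar>u n t\<bar>\<^sup>2 < \<epsilon>\<^sup>2" by (auto simp: v_def min_def split: if_splits)
      then show ?case using \<epsilon> power_less_imp_less_base[of "\<bar>u n t\<bar>" 2 \<epsilon>] by (simp add: u_def dist_real_def)
    qed
  qed
  have "weak_star_tendsto geo_push \<mu> (inf at_top (principal (- Z)))"
    unfolding weak_star_tendsto_def
  proof (intro allI impI)
    fix f :: "'a \<Rightarrow> real" assume "continuous_on UNIV f \<and> compact (closure {x. f x \<noteq> 0})"
    then have f: "f \<in> Cc" by (simp add: Cc_def)
    obtain B where B: "\<And>x. \<bar>f x\<bar> \<le> B" using Cc_bounded[OF f] by blast
    show "((\<lambda>t. \<integral>x. f x \<partial>geo_push t) \<longlongrightarrow> (\<integral>x. f x \<partial>\<mu>)) (inf at_top (principal (- Z)))"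
      by (rule tendsto_integral_of_countable[OF geo_push_prob horo.ergodic_prob_space[OF ergodic]
            horo.sets_ergodic[OF ergodic] D lim Cc_continuous[OF f] B])
  qed
  with Z(1) show ?thesis by blast
qed

end

end

end

theorem theorem1p1:
  fixes act :: "real^2^2 \<Rightarrow> 'a :: {second_countable_topology, t2_space} \<Rightarrow> 'a"
    and \<nu> \<mu> :: "'a measure"
  assumes "locally_compact_space (euclidean :: 'a topology)"
    and "continuous_SL2R_action act"
    and "prob_space \<nu>" and "sets \<nu> = sets borel"
    and "(\<forall>s. push (act (horo s)) \<nu> = \<nu>)
       \<or> (\<exists>x S. S > 0 \<and> \<nu> = time_average S (\<lambda>s. push (act (horo s)) (dirac x)))
       \<or> (\<exists>x \<Theta>. \<Theta> > 0 \<and> \<nu> = time_average \<Theta> (\<lambda>\<theta>. push (act (rot \<theta>)) (dirac x)))"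
    and "weak_star_tendsto (\<lambda>T. time_average T (\<lambda>t. push (act (geo t)) \<nu>)) \<mu> at_top"
    and "flow_ergodic (\<lambda>s. act (horo s)) \<mu>"
  shows "\<exists>Z. zero_upper_density Z \<and>
           weak_star_tendsto (\<lambda>t. push (act (geo t)) \<nu>) \<mu> (inf at_top (principal (- Z)))"
proof -
  interpret SL2R_action act by standard fact
  have "asymptotically_invariant \<nu>"
    using assms(5) asymptotically_invariant_horo_invariant[OF assms(3,4)]
      asymptotically_invariant_horo_arc[OF assms(3,4)] asymptotically_invariant_rot_arc[OF assms(3,4)]
    by blast
  from tendsto_outside_zero_density[OF assms(3,4) this assms(6,7,1)] show ?thesis .
qed

end
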